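(* Let $\mathcal{K}:\mathbb{R}\to\mathbb{R}$ be a square summable (i.e. $\int \mathcal{K}^2<\infty$) kernel function whose Fourier transform is different from zero almost everywhere, let $h>0$, and let $Y_1,\ldots,Y_K$ be real random variables (with finite variance). Let $\psi_{\mathbf{Y}}$ be the joint characteristic function of $\mathbf{Y}=(Y_1,\ldots,Y_K)^T$, $\psi_{Y_k}$ the characteristic function of $Y_k$, $\psi_{\mathcal{K}_h}$ the Fourier transform of $\mathcal{K}_h$, and $$D^c_{\mathbf{Y}}(y_1,\ldots,y_K)=\psi_{\mathbf{Y}}(y_1,\ldots,y_K)-\prod_{k=1}^{K}\psi_{Y_k}(y_k).$$ Then $$Q(Y_1,\ldots,Y_K)=\frac12\int_{\mathbb{R}^K}\prod_{k=1}^{K}\frac{\sigma_{Y_k}\,\big|\psi_{\mathcal{K}_h}(\sigma_{Y_k}y_k)\big|^2}{2\pi}\;\big|D^c_{\mathbf{Y}}(y_1,\ldots,y_K)\big|^2\,dy_1\cdots dy_K .$$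
   Context: Set $\mathcal{K}_h(x)=\mathcal{K}(x/h)/h$. The Fourier transform of a function $f$ on $\mathbb{R}$ is $\psi_f(t)=\int e^{itx}f(x)\,dx$ (understood in the $L^2$ sense when $f$ is only square summable). For each $k$, $\sigma_{Y_k}>0$ is a scale factor, i.e. the value at $Y_k$ of a functional $\sigma$ of the distribution, positive at $Y_k$, satisfying $\sigma_{\lambda Y_k}=|\lambda|\sigma_{Y_k}$ for every nonzero real constant $\lambda$. Define $$D_{\mathbf{Y}}(y_1,\ldots,y_K)=E\left[\prod_{k=1}^{K}\mathcal{K}_h\left(y_k-\frac{Y_k}{\sigma_{Y_k}}\right)\right]-\prod_{k=1}^{K}E\left[\mathcal{K}_h\left(y_k-\frac{Y_k}{\sigma_{Y_k}}\right)\right].$$ The quadratic dependence of $Y_1,\ldots,Y_K$ is $$Q(Y_1,\ldots,Y_K)=\frac12\int_{\mathbb{R}^K} D_{\mathbf{Y}}(y_1,\ldots,y_K)^2\,dy_1\cdots dy_K .$$ *)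

theory Defs
  imports "HOL-Probability.Probability"
begin

text \<open>
  Square summability on the real line, for real- or complex-valued functions. Measurability is
  Borel measurability, so that composing with a random variable gives a random variable.
\<close>

definition square_summable :: "(real \<Rightarrow> 'b::{real_normed_field, second_countable_topology}) \<Rightarrow> bool" where
  "square_summable f \<longleftrightarrow> f \<in> borel_measurable borel \<and> integrable lborel (\<lambda>x. (norm (f x))\<^sup>2)"

text \<open>
  The function \<open>g\<close> is a version of the Fourier transform of \<open>f\<close> in the mean-square sense: it is the
  limit in mean square, as \<open>n\<close> tends to infinity, of the integrals of \<open>exp (i t x) f x\<close> over
  \<open>[-n, n]\<close>. The squared distances are extended nonnegative reals, so an infinite distance
  is not mistaken for zero.
\<close>

definition is_L2_fourier_transform :: "(real \<Rightarrow> real) \<Rightarrow> (real \<Rightarrow> complex) \<Rightarrow> bool" where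
  "is_L2_fourier_transform f g \<longleftrightarrow>
     square_summable g \<and>
     (\<lambda>n::nat. \<integral>\<^sup>+ t. ennreal ((cmod (g t -
         (LINT x:{- real n..real n}|lborel. iexp (t * x) * complex_of_real (f x))))\<^sup>2) \<partial>lborel)
       \<longlonglongrightarrow> 0"

text \<open>
  The defining integral is used whenever it converges absolutely. Otherwise the transform is
  taken in the mean-square sense; it is then determined only almost everywhere, and the choice
  operator picks one version.
\<close>

definition fourier_transform :: "(real \<Rightarrow> real) \<Rightarrow> real \<Rightarrow> complex" where
  "fourier_transform f =
     (if integrable lborel f
      then (\<lambda>t. LINT x|lborel. iexp (t * x) * complex_of_real (f x))
      else (SOME g. is_L2_fourier_transform f g))"

definition scaled_kernel :: "(real \<Rightarrow> real) \<Rightarrow> real \<Rightarrow> real \<Rightarrow> real" where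
  "scaled_kernel \<K> h x = \<K> (x / h) / h"

text \<open>
  A random vector \<open>(Y 1, \<dots>, Y K)\<close> is a family \<open>Y :: nat \<Rightarrow> 'a \<Rightarrow> real\<close> of which only the members
  with index in \<open>{1..K}\<close> matter, and \<open>K\<close>-dimensional Euclidean space is the product of \<open>K\<close>
  copies of Lebesgue measure. The scale functional \<open>\<sigma>\<close> acts on distributions, i.e. on measures
  on the real line.
\<close>

abbreviation law :: "'a measure \<Rightarrow> ('a \<Rightarrow> real) \<Rightarrow> real measure" where
  "law M X \<equiv> distr M borel X"

definition kernel_dependence ::
    "'a measure \<Rightarrow> (real measure \<Rightarrow> real) \<Rightarrow> (real \<Rightarrow> real) \<Rightarrow> real \<Rightarrow> nat \<Rightarrow>
     (nat \<Rightarrow> 'a \<Rightarrow> real) \<Rightarrow> (nat \<Rightarrow> real) \<Rightarrow> real" where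
  "kernel_dependence M \<sigma> \<K> h K Y y =
     (LINT \<omega>|M. (\<Prod>k\<in>{1..K}. scaled_kernel \<K> h (y k - Y k \<omega> / \<sigma> (law M (Y k)))))
     - (\<Prod>k\<in>{1..K}. LINT \<omega>|M. scaled_kernel \<K> h (y k - Y k \<omega> / \<sigma> (law M (Y k))))"

definition quadratic_dependence ::
    "'a measure \<Rightarrow> (real measure \<Rightarrow> real) \<Rightarrow> (real \<Rightarrow> real) \<Rightarrow> real \<Rightarrow> nat \<Rightarrow>
     (nat \<Rightarrow> 'a \<Rightarrow> real) \<Rightarrow> real" where
  "quadratic_dependence M \<sigma> \<K> h K Y =
     1 / 2 * (LINT y|Pi\<^sub>M {1..K} (\<lambda>_. lborel). (kernel_dependence M \<sigma> \<K> h K Y y)\<^sup>2)"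

definition joint_char :: "'a measure \<Rightarrow> nat \<Rightarrow> (nat \<Rightarrow> 'a \<Rightarrow> real) \<Rightarrow> (nat \<Rightarrow> real) \<Rightarrow> complex" where
  "joint_char M K Y t = (LINT \<omega>|M. iexp (\<Sum>k\<in>{1..K}. t k * Y k \<omega>))"

definition char_dependence :: "'a measure \<Rightarrow> nat \<Rightarrow> (nat \<Rightarrow> 'a \<Rightarrow> real) \<Rightarrow> (nat \<Rightarrow> real) \<Rightarrow> complex" where
  "char_dependence M K Y t = joint_char M K Y t - (\<Prod>k\<in>{1..K}. char (law M (Y k)) (t k))"

end

(*
  Both sides are evaluated through the autocorrelation r(u) of the kernel f = K_h, i.e. the integral
  of f(x) f(x + u) dx. Let W be a vector with independent components W_k distributed as Y_k. Then D
  is almost everywhere the difference of the functions E prod_k f(y_k - Z_k / sigma_k) for Z = Y and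
  Z = W, and by Fubini the inner product of two such functions, with Z and independent Z', is
  E prod_k r((Z_k - Z'_k) / sigma_k). One-dimensional Plancherel in the form
  2 pi r(u) = integral of exp(i t u) |psi_f(t)|^2 dt, applied to each factor, turns this into the
  weighted inner product of the characteristic functions of Z and Z'; expanding the square finishes
  the proof. The identity is needed for every u, not just almost every u, because Y may have atoms.
  It comes from Gaussian summation and the continuity of r.
*)
theory Submission
  imports Defs
begin

section \<open>Continuity of translations and autocorrelation\<close>

text \<open>A Plancherel theorem on R^K applied to D itself would need mean-square transforms in K
  variables and an exchange of that limit with the expectation. Inner products instead put the
  randomness inside \<open>autocorrelation\<close>, which is bounded, and inside characters, so
  every Fubini exchange converges absolutely and the integrals over R^K factor into one-dimensional
  ones. What shapes the rest is that the kernel is merely square summable. Its expectations are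
  known to converge only for almost every y, hence product formulas in y are claimed almost
  everywhere. Its transform may be a version picked by choice, so it is used only through |psi|^2
  under an integral sign. Finally, integrability of |psi|^2 is itself part of Plancherel: for
  integrable kernels it is extracted from the Gaussian identity by monotone convergence, and the
  other kernels are reached by truncation to [-n, n].\<close>

lemma integrable_translate:
  fixes f :: "real \<Rightarrow> 'a::{banach, second_countable_topology}"
  assumes "integrable lborel f"
  shows "integrable lborel (\<lambda>x. f (x + u))"
  using lborel_integrable_real_affine[OF assms, of 1 u] by (simp add: add.commute)

lemma integral_translate:
  fixes f :: "real \<Rightarrow> 'a::{banach, second_countable_topology}"
  shows "(LINT x|lborel. f (x + u)) = (LINT x|lborel. f x)"
  using lborel_integral_real_affine[of 1 f u] by (simp add: add.commute)

text \<open>A three-epsilon argument: shifting \<open>f - g\<close> does not change its L1 norm, so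
  one approximant \<open>g\<close> serves all shifts \<open>X n\<close>. Both the passage from open
  to measurable sets and the limit step of the induction below rest on it.\<close>

lemma translation_tendsto_L1_approx:
  fixes f :: "real \<Rightarrow> real"
  assumes f: "integrable lborel f"
    and approx: "\<And>e. e > 0 \<Longrightarrow> \<exists>g. integrable lborel g \<and> (LINT x|lborel. \<bar>f x - g x\<bar>) < e
          \<and> (\<lambda>n. LINT x|lborel. \<bar>g (x + X n) - g x\<bar>) \<longlonglongrightarrow> 0"
  shows "(\<lambda>n. LINT x|lborel. \<bar>f (x + X n) - f x\<bar>) \<longlonglongrightarrow> 0"
proof (rule LIMSEQ_I)
  fix e :: real assume "e > 0"
  then obtain g where g: "integrable lborel g" "(LINT x|lborel. \<bar>f x - g x\<bar>) < e / 3"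
    "(\<lambda>n. LINT x|lborel. \<bar>g (x + X n) - g x\<bar>) \<longlonglongrightarrow> 0"
    using approx[of "e / 3"] by auto
  obtain N where N: "\<And>n. n \<ge> N \<Longrightarrow> norm ((LINT x|lborel. \<bar>g (x + X n) - g x\<bar>) - 0) < e / 3"
    using LIMSEQ_D[OF g(3), of "e / 3"] \<open>e > 0\<close> by auto
  note [simp] = f g(1) integrable_translate
  have "norm ((LINT x|lborel. \<bar>f (x + X n) - f x\<bar>) - 0) < e" if "n \<ge> N" for n
  proof -
    have "(LINT x|lborel. \<bar>f (x + X n) - f x\<bar>)
        \<le> (LINT x|lborel. \<bar>f (x + X n) - g (x + X n)\<bar> + \<bar>g (x + X n) - g x\<bar> + \<bar>f x - g x\<bar>)"
      by (intro integral_mono) auto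
    also have "\<dots> = (LINT x|lborel. \<bar>f (x + X n) - g (x + X n)\<bar>)
        + (LINT x|lborel. \<bar>g (x + X n) - g x\<bar>) + (LINT x|lborel. \<bar>f x - g x\<bar>)"
      by simp
    also have "(LINT x|lborel. \<bar>f (x + X n) - g (x + X n)\<bar>) = (LINT x|lborel. \<bar>f x - g x\<bar>)"
      by (rule integral_translate[of "\<lambda>x. \<bar>f x - g x\<bar>"])
    finally have "(LINT x|lborel. \<bar>f (x + X n) - f x\<bar>) < e"
      using g(2) N[OF that] by simp
    moreover have "(LINT x|lborel. \<bar>f (x + X n) - f x\<bar>) \<ge> 0" by simp
    ultimately show ?thesis by simp
  qed
  then show "\<exists>N. \<forall>n\<ge>N. norm ((LINT x|lborel. \<bar>f (x + X n) - f x\<bar>) - 0) < e" by blast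
qed

lemma translation_tendsto_L1_open:
  fixes U :: "real set"
  assumes U: "open U" "emeasure lborel U < \<infinity>" and X: "X \<longlonglongrightarrow> 0"
  shows "(\<lambda>n. LINT x|lborel. \<bar>indicator U (x + X n) - indicator U x\<bar> :: real) \<longlonglongrightarrow> 0"
proof -
  let ?i = "indicator U :: real \<Rightarrow> real"
  have [measurable]: "U \<in> sets borel" using U by simp
  have int[simp]: "integrable lborel ?i" using U by simp
  note int_translate[simp] = integrable_translate[OF int]
  \<comment> \<open>Openness of \<open>U\<close> controls only the positive part of \<open>?i x - ?i (x + X n)\<close>; the negative part has
    the same integral by translation invariance.\<close>
  have "(\<lambda>n. LINT x|lborel. max 0 (?i x - ?i (x + X n))) \<longlonglongrightarrow> (LINT x|(lborel :: real measure). 0)"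
  proof (rule integral_dominated_convergence[where w = ?i])
    show "AE x in lborel. (\<lambda>n. max 0 (?i x - ?i (x + X n))) \<longlonglongrightarrow> 0"
    proof (rule AE_I2)
      fix x :: real
      show "(\<lambda>n. max 0 (?i x - ?i (x + X n))) \<longlonglongrightarrow> 0"
      proof (cases "x \<in> U")
        case True
        have "(\<lambda>n. x + X n) \<longlonglongrightarrow> x" using tendsto_add[OF tendsto_const X] by simp
        then have "\<forall>\<^sub>F n in sequentially. x + X n \<in> U"
          using U(1) True by (rule topological_tendstoD)
        then have "\<forall>\<^sub>F n in sequentially. max 0 (?i x - ?i (x + X n)) = 0"
          by eventually_elim (simp add: True)
        then show ?thesis by (rule tendsto_eventually)
      qed (simp add: indicator_def)
    qed
  qed (auto simp: indicator_def)
  then have lim: "(\<lambda>n. 2 * (LINT x|lborel. max 0 (?i x - ?i (x + X n)))) \<longlonglongrightarrow> 0"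
    using tendsto_mult_right_zero by fastforce
  have "(LINT x|lborel. \<bar>?i (x + X n) - ?i x\<bar>) = 2 * (LINT x|lborel. max 0 (?i x - ?i (x + X n)))" for n
  proof -
    have "(LINT x|lborel. \<bar>?i (x + X n) - ?i x\<bar>)
        = (LINT x|lborel. 2 * max 0 (?i x - ?i (x + X n)) + (?i (x + X n) - ?i x))"
      by (intro Bochner_Integration.integral_cong) (auto simp: max_def)
    also have "\<dots> = 2 * (LINT x|lborel. max 0 (?i x - ?i (x + X n)))
        + ((LINT x|lborel. ?i (x + X n)) - (LINT x|lborel. ?i x))"
      by (subst Bochner_Integration.integral_add) auto
    also have "(LINT x|lborel. ?i (x + X n)) = (LINT x|lborel. ?i x)"
      by (rule integral_translate)
    finally show ?thesis by simp
  qed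
  with lim show ?thesis by simp
qed

text \<open>\<open>integrable_induct\<close> leaves three cases: indicators of sets of finite
  measure, approximated from outside by open sets through outer regularity; sums, by the triangle
  inequality; and dominated pointwise limits, which are also L1 limits.\<close>

lemma translation_tendsto_L1:
  fixes f :: "real \<Rightarrow> real"
  assumes f: "integrable lborel f" and X: "X \<longlonglongrightarrow> 0"
  shows "(\<lambda>n. LINT x|lborel. \<bar>f (x + X n) - f x\<bar>) \<longlonglongrightarrow> 0"
  using f
proof (induction rule: integrable_induct)
  case (base A c)
  then have [measurable]: "A \<in> sets borel" by simp
  have ind: "(\<lambda>n. LINT x|lborel. \<bar>indicator A (x + X n) - indicator A x\<bar> :: real) \<longlonglongrightarrow> 0"
  proof (rule translation_tendsto_L1_approx)
    show "integrable lborel (indicator A :: real \<Rightarrow> real)" using base by simp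
    fix e :: real assume e: "e > 0"
    obtain U where U: "open U" "A \<subseteq> U" "emeasure lborel (U - A) < e"
      using outer_regular_lborel[of A e] e by auto
    have [measurable]: "U \<in> sets borel" using U by simp
    have fin: "emeasure lborel (U - A) < \<infinity>" by (rule less_trans[OF U(3)]) simp
    have "emeasure lborel U = emeasure lborel A + emeasure lborel (U - A)"
      using plus_emeasure[of A lborel "U - A"] U(2) by (simp add: Un_absorb1)
    with fin base have Ufin: "emeasure lborel U < \<infinity>" by (auto simp: less_top)
    have "(LINT x|lborel. \<bar>indicator A x - indicator U x\<bar> :: real) = (LINT x|lborel. indicator (U - A) x)"
      using U(2) by (intro Bochner_Integration.integral_cong) (auto simp: indicator_def)
    also have "\<dots> = measure lborel (U - A)" by simp
    also have "\<dots> < e" using U(3) e fin by (simp add: measure_def enn2real_less_iff)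
    finally show "\<exists>g. integrable lborel g \<and> (LINT x|lborel. \<bar>indicator A x - g x\<bar>) < e
          \<and> (\<lambda>n. LINT x|lborel. \<bar>g (x + X n) - g x\<bar>) \<longlonglongrightarrow> 0"
      using translation_tendsto_L1_open[OF U(1) Ufin X] Ufin by (intro exI[of _ "indicator U"]) auto
  qed
  have "(LINT x|lborel. \<bar>indicator A (x + X n) *\<^sub>R c - indicator A x *\<^sub>R c\<bar>)
      = (LINT x|lborel. \<bar>indicator A (x + X n) - indicator A x\<bar> :: real) * \<bar>c\<bar>" for n
    by (simp add: left_diff_distrib[symmetric] abs_mult)
  with tendsto_mult_left_zero[OF ind, of "\<bar>c\<bar>"] show ?case by simp
next
  case (add f g)
  note [simp] = add.hyps integrable_translate
  have "(LINT x|lborel. \<bar>f (x + X n) + g (x + X n) - (f x + g x)\<bar>)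
      \<le> (LINT x|lborel. \<bar>f (x + X n) - f x\<bar>) + (LINT x|lborel. \<bar>g (x + X n) - g x\<bar>)" for n
  proof -
    have "(LINT x|lborel. \<bar>f (x + X n) + g (x + X n) - (f x + g x)\<bar>)
        \<le> (LINT x|lborel. \<bar>f (x + X n) - f x\<bar> + \<bar>g (x + X n) - g x\<bar>)"
      by (intro integral_mono) auto
    then show ?thesis by simp
  qed
  then show ?case
    by (intro tendsto_sandwich[OF _ _ tendsto_const tendsto_add_zero[OF add.IH]] always_eventually)
       auto
next
  case (lim f s)
  show ?case
  proof (rule translation_tendsto_L1_approx[OF \<open>integrable lborel f\<close>])
    fix e :: real assume e: "e > 0"
    \<comment> \<open>The induction provides \<open>norm (s i x) \<le> 2 * norm (f x)\<close>,
      whence the dominating function \<open>3 * \<bar>f x\<bar>\<close>.\<close>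
    have "(\<lambda>i. LINT x|lborel. \<bar>f x - s i x\<bar>) \<longlonglongrightarrow> (LINT x|(lborel :: real measure). 0)"
    proof (rule integral_dominated_convergence[where w = "\<lambda>x. 3 * \<bar>f x\<bar>"])
      show "AE x in lborel. (\<lambda>i. \<bar>f x - s i x\<bar>) \<longlonglongrightarrow> 0"
      proof (rule AE_I2)
        fix x :: real
        have "(\<lambda>i. s i x) \<longlonglongrightarrow> f x" using lim by simp
        from tendsto_rabs[OF tendsto_diff[OF tendsto_const this, of "f x"]]
        show "(\<lambda>i. \<bar>f x - s i x\<bar>) \<longlonglongrightarrow> 0" by simp
      qed
      show "AE x in lborel. norm \<bar>f x - s i x\<bar> \<le> 3 * \<bar>f x\<bar>" for i
      proof (rule AE_I2)
        fix x :: real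
        have "norm (s i x) \<le> 2 * norm (f x)" using lim by simp
        then show "norm \<bar>f x - s i x\<bar> \<le> 3 * \<bar>f x\<bar>" by simp
      qed
    qed (use lim in auto)
    then have "\<forall>\<^sub>F i in sequentially. (LINT x|lborel. \<bar>f x - s i x\<bar>) < e"
      using e by (intro order_tendstoD(2)) auto
    then obtain i where "(LINT x|lborel. \<bar>f x - s i x\<bar>) < e"
      by (auto simp: eventually_sequentially)
    then show "\<exists>g. integrable lborel g \<and> (LINT x|lborel. \<bar>f x - g x\<bar>) < e
          \<and> (\<lambda>n. LINT x|lborel. \<bar>g (x + X n) - g x\<bar>) \<longlonglongrightarrow> 0"
      using lim by blast
  qed
qed

section \<open>Tools for continuity of translations in mean square\<close>

lemma integrable_mult_square:
  fixes f g :: "'a \<Rightarrow> real"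
  assumes [measurable]: "f \<in> borel_measurable M" "g \<in> borel_measurable M"
    and "integrable M (\<lambda>x. (f x)\<^sup>2)" "integrable M (\<lambda>x. (g x)\<^sup>2)"
  shows "integrable M (\<lambda>x. f x * g x)"
proof (rule Bochner_Integration.integrable_bound)
  show "integrable M (\<lambda>x. (f x)\<^sup>2 + (g x)\<^sup>2)" using assms by simp
  have "\<bar>f x * g x\<bar> \<le> (f x)\<^sup>2 + (g x)\<^sup>2" for x
    using sum_squares_bound[of "\<bar>f x\<bar>" "\<bar>g x\<bar>"] abs_ge_zero[of "f x * g x"]
    unfolding abs_mult power2_abs by linarith
  then show "AE x in M. norm (f x * g x) \<le> norm ((f x)\<^sup>2 + (g x)\<^sup>2)"
    by (intro AE_I2) (simp add: order_trans[OF _ abs_ge_self])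
qed simp

text \<open>Stands in for Cauchy-Schwarz. A bound of the type sqrt (A * b n) appears as
  \<open>d * A + c d * b n\<close> with a free weight \<open>d\<close>: fixing a small
  \<open>d\<close> controls the first term, after which large \<open>n\<close> controls the
  second.\<close>

lemma tendsto_of_weighted_bound:
  fixes a :: "nat \<Rightarrow> 'a::metric_space"
  assumes b: "b \<longlonglongrightarrow> (0::real)"
    and bound: "\<And>d n. d > 0 \<Longrightarrow> dist (a n) l \<le> d * A + c d * b n"
  shows "a \<longlonglongrightarrow> l"
proof (rule tendstoI)
  fix e :: real assume e: "e > 0"
  \<comment> \<open>\<open>\<bar>A\<bar> + 1\<close> keeps the denominator positive for every real
    \<open>A\<close>.\<close>
  define d where "d = e / (2 * (\<bar>A\<bar> + 1))"
  have d: "d > 0" using e by (simp add: d_def)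
  have "d * A \<le> d * (\<bar>A\<bar> + 1)" using d by (intro mult_left_mono) auto
  also have "\<dots> = e / 2" by (simp add: d_def field_simps)
  finally have A: "d * A \<le> e / 2" .
  have "(\<lambda>n. c d * b n) \<longlonglongrightarrow> 0" using tendsto_mult_right_zero[OF b] .
  then have "\<forall>\<^sub>F n in sequentially. c d * b n < e / 2"
    using e by (intro order_tendstoD(2)) auto
  then show "\<forall>\<^sub>F n in sequentially. dist (a n) l < e"
    by eventually_elim (use bound[OF d] A in \<open>smt (verit) field_sum_of_halves\<close>)
qed

text \<open>
  With \<open>a = f (x + u)\<close> and \<open>b = f x\<close> this reduces the continuity of translations in mean square to
  their continuity in mean, applied to the integrable function \<open>f \<bar>f\<bar>\<close>.
\<close>

lemma square_diff_le_signed_squares: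
  fixes a b :: real
  shows "(a - b)\<^sup>2 \<le> 2 * \<bar>a * \<bar>a\<bar> - b * \<bar>b\<bar>\<bar>"
proof -
  have *: "(x - y)\<^sup>2 \<le> 2 * \<bar>x\<^sup>2 - y\<^sup>2\<bar>" if "0 \<le> y" "y \<le> x" for x y :: real
  proof -
    have "(x - y)\<^sup>2 \<le> (x - y) * (x + y)"
      unfolding power2_eq_square using that by (intro mult_left_mono) auto
    also have "\<dots> = x\<^sup>2 - y\<^sup>2" by (simp add: power2_eq_square algebra_simps)
    moreover have "x\<^sup>2 - y\<^sup>2 \<ge> 0" using that by (simp add: power_mono)
    ultimately show ?thesis by simp
  qed
  \<comment> \<open>For opposite signs the right-hand side is exactly
    \<open>2 * (a\<^sup>2 + b\<^sup>2)\<close>, so this crude bound is enough.\<close>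
  have **: "(x + y)\<^sup>2 \<le> 2 * (x\<^sup>2 + y\<^sup>2)" for x y :: real
    using sum_squares_bound[of x y] by (simp add: power2_sum)
  consider "0 \<le> a" "0 \<le> b" | "a \<le> 0" "b \<le> 0" | "0 \<le> a" "b \<le> 0" | "a \<le> 0" "0 \<le> b" by linarith
  then show ?thesis
  proof cases
    case 1
    then show ?thesis using *[of b a] *[of a b]
      by (cases "b \<le> a") (auto simp: power2_eq_square algebra_simps abs_minus_commute)
  next
    case 2
    then show ?thesis using *[of "- b" "- a"] *[of "- a" "- b"]
      by (cases "b \<le> a") (auto simp: power2_eq_square algebra_simps abs_minus_commute)
  next
    case 3
    then show ?thesis using **[of a "- b"]
      by (simp add: power2_eq_square algebra_simps)
  next
    case 4
    then show ?thesis using **[of "- a" b]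
      by (simp add: power2_eq_square algebra_simps)
  qed
qed

section \<open>The autocorrelation of a square summable function\<close>

definition autocorrelation :: "(real \<Rightarrow> real) \<Rightarrow> real \<Rightarrow> real" where
  "autocorrelation f u = (LINT x|lborel. f x * f (x + u))"

context
  fixes f :: "real \<Rightarrow> real"
  assumes meas[measurable]: "f \<in> borel_measurable borel"
    and square: "integrable lborel (\<lambda>x. (f x)\<^sup>2)"
begin

lemma integrable_square_translate: "integrable lborel (\<lambda>x. (f (x + u))\<^sup>2)"
  using integrable_translate[OF square] .

lemma integrable_mult_translate: "integrable lborel (\<lambda>x. f (x + v) * f (x + u))"
  by (intro integrable_mult_square integrable_square_translate) auto

lemma translation_tendsto_L2:
  assumes X: "X \<longlonglongrightarrow> 0"
  shows "(\<lambda>n. LINT x|lborel. (f (x + X n) - f x)\<^sup>2) \<longlonglongrightarrow> 0"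
proof -
  define g where "g x = f x * \<bar>f x\<bar>" for x
  have [measurable]: "g \<in> borel_measurable borel" unfolding g_def by measurable
  have g: "integrable lborel g"
    by (rule Bochner_Integration.integrable_bound[OF square])
       (auto simp: g_def abs_mult power2_eq_square)
  note [simp] = g integrable_translate
  have lim: "(\<lambda>n. 2 * (LINT x|lborel. \<bar>g (x + X n) - g x\<bar>)) \<longlonglongrightarrow> 0"
    using tendsto_mult_right_zero[OF translation_tendsto_L1[OF g X]] .
  have le: "(LINT x|lborel. (f (x + X n) - f x)\<^sup>2) \<le> 2 * (LINT x|lborel. \<bar>g (x + X n) - g x\<bar>)" for n
  proof -
    have "(LINT x|lborel. (f (x + X n) - f x)\<^sup>2) \<le> (LINT x|lborel. 2 * \<bar>g (x + X n) - g x\<bar>)"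
    proof (rule integral_mono_AE')
      show "AE x in lborel. (f (x + X n) - f x)\<^sup>2 \<le> 2 * \<bar>g (x + X n) - g x\<bar>"
        unfolding g_def by (intro AE_I2 square_diff_le_signed_squares)
    qed auto
    then show ?thesis by simp
  qed
  show ?thesis
    by (rule tendsto_sandwich[OF _ _ tendsto_const lim]) (simp, intro always_eventually allI le)
qed

text \<open>Inherited from the continuity of translations in mean square: Young's inequality with
  weight \<open>d\<close> separates \<open>f x\<close> from the increment of \<open>f\<close>, and
  translation invariance removes \<open>u\<close> from the increment.\<close>

lemma autocorrelation_tendsto:
  assumes X: "X \<longlonglongrightarrow> 0"
  shows "(\<lambda>n. autocorrelation f (u + X n)) \<longlonglongrightarrow> autocorrelation f u"
proof (rule tendsto_of_weighted_bound[OF translation_tendsto_L2[OF X]])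
  fix d :: real and n :: nat assume d: "d > 0"
  have int0: "integrable lborel (\<lambda>x. f x * f (x + v))" for v
    using integrable_mult_translate[of 0 v] by simp
  have sq: "integrable lborel (\<lambda>x. (f (x + u + X n) - f (x + u))\<^sup>2)"
    unfolding power2_diff
    using integrable_mult_translate[of "u + X n" "u"] integrable_square_translate[of "u + X n"]
      integrable_square_translate[of u]
    by (simp add: mult.assoc add.assoc)
  have "dist (autocorrelation f (u + X n)) (autocorrelation f u)
      = \<bar>LINT x|lborel. f x * f (x + (u + X n)) - f x * f (x + u)\<bar>"
    unfolding autocorrelation_def dist_real_def
    by (subst Bochner_Integration.integral_diff[OF int0 int0]) simp
  also have "\<dots> \<le> (LINT x|lborel. \<bar>f x * f (x + (u + X n)) - f x * f (x + u)\<bar>)"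
    by (rule integral_abs_bound)
  also have "\<dots> \<le> (LINT x|lborel. d * (f x)\<^sup>2 + (1 / d) * (f (x + u + X n) - f (x + u))\<^sup>2)"
  proof (rule integral_mono_AE')
    show "integrable lborel (\<lambda>x. d * (f x)\<^sup>2 + 1 / d * (f (x + u + X n) - f (x + u))\<^sup>2)"
      using sq square by simp
    have "\<bar>a * b - a * c\<bar> \<le> d * a\<^sup>2 + (1 / d) * (b - c)\<^sup>2" for a b c :: real
    proof -
      have "0 \<le> (sqrt d * \<bar>a\<bar> - \<bar>b - c\<bar> / sqrt d)\<^sup>2" by simp
      also have "\<dots> = d * a\<^sup>2 + (1 / d) * (b - c)\<^sup>2 - 2 * (\<bar>a\<bar> * \<bar>b - c\<bar>)"
        using d by (simp add: power2_diff power_mult_distrib power_divide)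
      finally have "2 * \<bar>a * (b - c)\<bar> \<le> d * a\<^sup>2 + (1 / d) * (b - c)\<^sup>2"
        by (simp add: abs_mult)
      then show ?thesis using abs_ge_zero[of "a * (b - c)"] by (simp only: right_diff_distrib[symmetric])
    qed
    then show "AE x in lborel. \<bar>f x * f (x + (u + X n)) - f x * f (x + u)\<bar>
        \<le> d * (f x)\<^sup>2 + 1 / d * (f (x + u + X n) - f (x + u))\<^sup>2"
      by (simp add: add.assoc)
  qed (use d in auto)
  also have "\<dots> = d * (LINT x|lborel. (f x)\<^sup>2)
      + (1 / d) * (LINT x|lborel. (f (x + u + X n) - f (x + u))\<^sup>2)"
    using sq square by simp
  also have "(LINT x|lborel. (f (x + u + X n) - f (x + u))\<^sup>2) = (LINT x|lborel. (f (x + X n) - f x)\<^sup>2)"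
    using integral_translate[of "\<lambda>x. (f (x + X n) - f x)\<^sup>2" u] by (simp add: ac_simps)
  finally show "dist (autocorrelation f (u + X n)) (autocorrelation f u)
      \<le> d * (LINT x|lborel. (f x)\<^sup>2) + (1 / d) * (LINT x|lborel. (f (x + X n) - f x)\<^sup>2)" .
qed

text \<open>The absolute value stays inside the integral so that the bound, uniform in
  \<open>u\<close>, also gives the absolute convergence that Fubini asks for once the shift is
  random.\<close>

lemma integral_abs_mult_translate_le: "(LINT x|lborel. \<bar>f x * f (x + u)\<bar>) \<le> (LINT x|lborel. (f x)\<^sup>2)"
proof -
  have "(LINT x|lborel. \<bar>f x * f (x + u)\<bar>) \<le> (LINT x|lborel. ((f x)\<^sup>2 + (f (x + u))\<^sup>2) / 2)"
  proof (rule integral_mono_AE')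
    have "\<bar>a * b\<bar> \<le> (a\<^sup>2 + b\<^sup>2) / 2" for a b :: real
      using sum_squares_bound[of "\<bar>a\<bar>" "\<bar>b\<bar>"] by (simp add: abs_mult)
    then show "AE x in lborel. \<bar>f x * f (x + u)\<bar> \<le> ((f x)\<^sup>2 + (f (x + u))\<^sup>2) / 2" by simp
  qed (use square integrable_square_translate in auto)
  also have "\<dots> = (LINT x|lborel. (f x)\<^sup>2)"
    using square integrable_square_translate[of u] integral_translate[of "\<lambda>x. (f x)\<^sup>2" u] by simp
  finally show ?thesis .
qed

lemma autocorrelation_bounded: "\<bar>autocorrelation f u\<bar> \<le> (LINT x|lborel. (f x)\<^sup>2)"
  unfolding autocorrelation_def
  by (rule order_trans[OF integral_abs_bound integral_abs_mult_translate_le])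

end

text \<open>Tonelli for a dominating function with separated variables, the form in which most of
  the Fubini exchanges below are justified.\<close>

lemma (in pair_sigma_finite) integrable_product_bound:
  fixes f :: "'a \<times> 'b \<Rightarrow> 'c::{banach, second_countable_topology}"
  assumes [measurable]: "f \<in> borel_measurable (M1 \<Otimes>\<^sub>M M2)"
    and g: "integrable M1 g" and h: "integrable M2 h"
    and le: "\<And>x y. norm (f (x, y)) \<le> g x * (h y :: real)"
  shows "integrable (M1 \<Otimes>\<^sub>M M2) f"
proof (rule integrableI_bounded)
  note [measurable] = borel_measurable_integrable[OF g] borel_measurable_integrable[OF h]
  have "(\<integral>\<^sup>+ p. ennreal (norm (f p)) \<partial>(M1 \<Otimes>\<^sub>M M2)) = (\<integral>\<^sup>+ x. \<integral>\<^sup>+ y. ennreal (norm (f (x, y))) \<partial>M2 \<partial>M1)"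
    by (simp add: M2.nn_integral_fst[symmetric])
  also have "\<dots> \<le> (\<integral>\<^sup>+ x. \<integral>\<^sup>+ y. ennreal (norm (g x)) * ennreal (norm (h y)) \<partial>M2 \<partial>M1)"
  proof (intro nn_integral_mono)
    fix x y
    have "norm (f (x, y)) \<le> \<bar>g x * h y\<bar>" using le[of x y] by linarith
    then show "ennreal (norm (f (x, y))) \<le> ennreal (norm (g x)) * ennreal (norm (h y))"
      by (simp add: abs_mult ennreal_mult[symmetric] ennreal_leI)
  qed
  also have "\<dots> = (\<integral>\<^sup>+ x. ennreal (norm (g x)) \<partial>M1) * (\<integral>\<^sup>+ y. ennreal (norm (h y)) \<partial>M2)"
    by (simp add: nn_integral_cmult nn_integral_multc)
  also have "\<dots> < \<infinity>"
    using g h by (simp add: integrable_iff_bounded ennreal_mult_less_top)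
  finally show "(\<integral>\<^sup>+ p. ennreal (norm (f p)) \<partial>(M1 \<Otimes>\<^sub>M M2)) < \<infinity>" .
qed simp

section \<open>Fourier transforms of integrable functions\<close>

definition fourier_integral :: "(real \<Rightarrow> real) \<Rightarrow> real \<Rightarrow> complex" where
  "fourier_integral f t = (LINT x|lborel. iexp (t * x) * complex_of_real (f x))"

text \<open>Phrased with \<open>Im s = 0\<close> because simplification splits
  \<open>complex_of_real (t * x)\<close>, and the exponent then no longer is a single embedded
  real.\<close>

lemma norm_exp_ii_mult [simp]: "Im s = 0 \<Longrightarrow> norm (exp (\<i> * s) * z) = norm z"
  by (simp add: norm_mult norm_exp_eq_Re)

lemma borel_measurable_fourier_integral [measurable]:
  assumes [measurable]: "f \<in> borel_measurable borel"
  shows "fourier_integral f \<in> borel_measurable borel"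
  unfolding fourier_integral_def by measurable

lemma integral_std_normal:
  fixes g :: "real \<Rightarrow> 'b::{banach, second_countable_topology}"
  assumes "g \<in> borel_measurable borel"
  shows "(LINT z|std_normal_distribution. g z) = (LINT z|lborel. std_normal_density z *\<^sub>R g z)"
  by (rule integral_density) (use assms in auto)

lemma gaussian_weight_tendsto: "(\<lambda>n. exp (- (t / real (Suc n))\<^sup>2 / 2)) \<longlonglongrightarrow> (1 :: real)"
proof -
  have "(\<lambda>n. t / real (Suc n)) \<longlonglongrightarrow> 0"
    using LIMSEQ_Suc[OF lim_const_over_n[of t]] by simp
  then have "(\<lambda>n. exp (- (t / real (Suc n))\<^sup>2 / 2)) \<longlonglongrightarrow> exp (- 0\<^sup>2 / 2)"
    by (intro tendsto_intros) auto
  then show ?thesis by simp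
qed

section \<open>The autocorrelation identity for integrable, square summable functions\<close>

context
  fixes f :: "real \<Rightarrow> real"
  assumes f[measurable]: "integrable lborel f"
    and square: "integrable lborel (\<lambda>x. (f x)\<^sup>2)"
begin

lemma borel_measurable_integrand: "f \<in> borel_measurable borel"
  using f by simp

lemma integrable_fourier_integrand: "integrable lborel (\<lambda>x. iexp (t * x) * complex_of_real (f x))"
  by (rule Bochner_Integration.integrable_bound[OF f]) auto

lemma norm_fourier_integral_le: "cmod (fourier_integral f t) \<le> (LINT x|lborel. \<bar>f x\<bar>)"
  unfolding fourier_integral_def by (rule order_trans[OF integral_norm_bound]) simp

lemma integrable_kernel_pair:
  "integrable (lborel \<Otimes>\<^sub>M lborel) (\<lambda>p. f (fst p) * f (snd p))"
  by (rule lborel_pair.integrable_product_bound[OF _ integrable_abs[OF f] integrable_abs[OF f]])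
     (auto simp: abs_mult)

text \<open>Integrability of \<open>f\<close> makes this double integral absolutely convergent, so
  an average over the frequency \<open>s\<close> can be moved inside and acts on the exponential
  alone.\<close>

lemma norm_fourier_integral_square:
  "complex_of_real ((cmod (fourier_integral f s))\<^sup>2) =
    (LINT p|(lborel \<Otimes>\<^sub>M lborel). iexp (s * (fst p - snd p)) * complex_of_real (f (fst p) * f (snd p)))"
proof -
  let ?g = "\<lambda>x. iexp (s * x) * complex_of_real (f x)"
  have "complex_of_real ((cmod (fourier_integral f s))\<^sup>2) = fourier_integral f s * cnj (fourier_integral f s)"
    by (rule complex_norm_square)
  also have "\<dots> = (LINT x|lborel. ?g x) * (LINT y|lborel. cnj (?g y))"
    unfolding fourier_integral_def Bochner_Integration.integral_cnj ..
  also have "\<dots> = (LINT x|lborel. LINT y|lborel. ?g x * cnj (?g y))"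
    by simp
  also have "\<dots> = (LINT x|lborel. LINT y|lborel.
      iexp (s * (x - y)) * complex_of_real (f x * f y))"
    by (intro Bochner_Integration.integral_cong refl)
       (simp add: exp_cnj exp_minus exp_diff right_diff_distrib divide_inverse ac_simps)
  also have "\<dots> = (LINT p|(lborel \<Otimes>\<^sub>M lborel). (case p of (x, y) \<Rightarrow>
      iexp (s * (x - y)) * complex_of_real (f x * f y)))"
  proof (rule lborel_pair.integral_fst)
    show "integrable (lborel \<Otimes>\<^sub>M lborel)
        (\<lambda>(x, y). iexp (s * (x - y)) * complex_of_real (f x * f y))"
      by (rule Bochner_Integration.integrable_bound[OF integrable_kernel_pair])
         (auto simp: split_beta' norm_mult abs_mult)
  qed
  finally show ?thesis by (simp add: split_beta')
qed

text \<open>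
  The Gaussian weight is introduced as a standard normal random frequency \<open>T\<close>, so that its Fourier
  transform is the known characteristic function of the normal distribution.
\<close>

lemma integral_normal_fourier_eq_pair:
  "(LINT T|std_normal_distribution. iexp (c * T * u) * complex_of_real ((cmod (fourier_integral f (c * T)))\<^sup>2))
    = complex_of_real (LINT p|(lborel \<Otimes>\<^sub>M lborel).
        f (fst p) * f (snd p) * exp (- ((c * (fst p - snd p + u))\<^sup>2) / 2))"
proof -
  let ?N = std_normal_distribution and ?P = "lborel \<Otimes>\<^sub>M lborel :: (real \<times> real) measure"
  interpret N: real_distribution ?N by (rule real_dist_normal_dist)
  interpret NP: pair_sigma_finite ?N ?P ..
  let ?G = "\<lambda>T p. iexp (T * (c * (fst p - snd p + u))) * complex_of_real (f (fst p) * f (snd p))"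
  have int: "integrable (?N \<Otimes>\<^sub>M ?P) (case_prod ?G)"
    by (rule NP.integrable_product_bound[where g = "\<lambda>_. 1", OF _ _ integrable_abs[OF integrable_kernel_pair]])
       (auto simp: split_beta' abs_mult norm_mult)
  have key: "iexp (c * T * u) * (iexp (c * T * (a - b)) * z) = iexp (T * (c * (a - b + u))) * z"
    for T a b z
  proof -
    have "iexp (T * (c * (a - b + u))) = iexp (c * T * u) * iexp (c * T * (a - b))"
      unfolding exp_add[symmetric] by (simp add: algebra_simps)
    then show ?thesis by (simp only: mult.assoc)
  qed
  have "(LINT T|?N. iexp (c * T * u) * complex_of_real ((cmod (fourier_integral f (c * T)))\<^sup>2))
      = (LINT T|?N. LINT p|?P. ?G T p)"
    unfolding norm_fourier_integral_square integral_mult_right_zero[symmetric]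
    by (intro Bochner_Integration.integral_cong refl) (rule key)
  also have "\<dots> = (LINT p|?P. LINT T|?N. ?G T p)"
    by (rule NP.Fubini_integral[OF int, symmetric])
  also have "\<dots> = (LINT p|?P. char ?N (c * (fst p - snd p + u)) * complex_of_real (f (fst p) * f (snd p)))"
    unfolding char_def integral_mult_left_zero
    by (intro Bochner_Integration.integral_cong refl) (simp add: mult.commute)
  also have "\<dots> = (LINT p|?P. complex_of_real
      (f (fst p) * f (snd p) * exp (- ((c * (fst p - snd p + u))\<^sup>2) / 2)))"
    by (intro Bochner_Integration.integral_cong refl) (simp add: char_std_normal_distribution)
  also have "\<dots> = complex_of_real (LINT p|?P.
      f (fst p) * f (snd p) * exp (- ((c * (fst p - snd p + u))\<^sup>2) / 2))"
    by (rule integral_complex_of_real)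
  finally show ?thesis .
qed

text \<open>The Gaussian factor concentrates at \<open>y = x + u\<close>. The substitution
  \<open>y = x + u + z / c\<close> turns it into the standard normal density times
  \<open>sqrt (2 * pi)\<close>, with Jacobian \<open>1 / c\<close>; what remains is the
  autocorrelation at a shift with small normal noise.\<close>

lemma integral_pair_normal_eq_autocorrelation:
  assumes c: "c > 0"
  shows "(LINT p|(lborel \<Otimes>\<^sub>M lborel). f (fst p) * f (snd p) * exp (- ((c * (fst p - snd p + u))\<^sup>2) / 2))
    = sqrt (2 * pi) / c * (LINT z|std_normal_distribution. autocorrelation f (u + z / c))"
proof -
  let ?N = std_normal_distribution
  interpret N: real_distribution ?N by (rule real_dist_normal_dist)
  interpret LN: pair_sigma_finite "lborel :: real measure" ?N ..
  let ?H = "\<lambda>x y. f x * f y * exp (- ((c * (x - y + u))\<^sup>2) / 2)"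
  have "integrable (lborel \<Otimes>\<^sub>M lborel) (\<lambda>(x, y). ?H x y)"
    by (rule Bochner_Integration.integrable_bound[OF integrable_kernel_pair])
       (auto simp: split_beta' abs_mult mult_le_cancel_left1 intro!: mult_right_le_one_le)
  from lborel_pair.integral_fst[OF this]
  have "(LINT p|(lborel \<Otimes>\<^sub>M lborel). ?H (fst p) (snd p)) = (LINT x|lborel. LINT y|lborel. ?H x y)"
    by (simp add: split_beta')
  also have "\<dots> = (LINT x|lborel. LINT z|?N. sqrt (2 * pi) / c * (f x * f (x + (u + z / c))))"
  proof (rule Bochner_Integration.integral_cong[OF refl])
    fix x
    have "(LINT y|lborel. ?H x y) = \<bar>1 / c\<bar> *\<^sub>R (LINT z|lborel. ?H x ((x + u) + 1 / c * z))"
      using c by (intro lborel_integral_real_affine) simp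
    also have "\<dots> = (LINT z|lborel. std_normal_density z *\<^sub>R (sqrt (2 * pi) / c * (f x * f (x + (u + z / c)))))"
      unfolding integral_scaleR_right[symmetric]
      using c by (intro Bochner_Integration.integral_cong refl) (simp add: std_normal_density_def add.assoc)
    also have "\<dots> = (LINT z|?N. sqrt (2 * pi) / c * (f x * f (x + (u + z / c))))"
      by (rule integral_std_normal[symmetric]) measurable
    finally show "(LINT y|lborel. ?H x y) = (LINT z|?N. sqrt (2 * pi) / c * (f x * f (x + (u + z / c))))" .
  qed
  also have "\<dots> = sqrt (2 * pi) / c * (LINT x|lborel. LINT z|?N. f x * f (x + (u + z / c)))"
    by simp
  also have "(LINT x|lborel. LINT z|?N. f x * f (x + (u + z / c)))
      = (LINT z|?N. LINT x|lborel. f x * f (x + (u + z / c)))"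
  proof (rule LN.Fubini_integral[symmetric])
    \<comment> \<open>With \<open>x\<close> innermost the absolute integral is bounded uniformly in
      \<open>z\<close>, and a constant is integrable for the probability measure
      \<open>?N\<close>.\<close>
    have "integrable (?N \<Otimes>\<^sub>M lborel) (\<lambda>(z, x). f x * f (x + (u + z / c)))"
    proof (rule pair_sigma_finite.Fubini_integrable)
      show "pair_sigma_finite ?N (lborel :: real measure)" ..
      show "integrable ?N (\<lambda>z. LINT x|lborel. norm (case (z, x) of (z, x) \<Rightarrow> f x * f (x + (u + z / c))))"
        by (rule N.integrable_const_bound[where B = "LINT x|lborel. (f x)\<^sup>2"])
           (use integral_abs_mult_translate_le[OF borel_measurable_integrand square] in auto)
      show "AE z in ?N. integrable lborel (\<lambda>x. case (z, x) of (z, x) \<Rightarrow> f x * f (x + (u + z / c)))"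
        using integrable_mult_translate[OF borel_measurable_integrand square, of 0] by simp
    qed measurable
    then show "integrable (lborel \<Otimes>\<^sub>M ?N) (\<lambda>(x, z). f x * f (x + (u + z / c)))"
      by (subst LN.integrable_product_swap_iff[symmetric]) simp
  qed
  finally show ?thesis unfolding autocorrelation_def .
qed

text \<open>The constant \<open>2 * pi\<close> is a product of two factors
  \<open>sqrt (2 * pi)\<close>, one from the density of the random frequency and one from the
  density of the noise \<open>z\<close>; the powers of \<open>c\<close> from the two substitutions
  cancel.\<close>

lemma integral_gaussian_fourier:
  assumes c: "c > 0"
  shows "(LINT t|lborel. exp (- (t / c)\<^sup>2 / 2) *\<^sub>R (iexp (t * u) * complex_of_real ((cmod (fourier_integral f t))\<^sup>2)))
    = complex_of_real (2 * pi * (LINT z|std_normal_distribution. autocorrelation f (u + z / c)))"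
proof -
  let ?g = "\<lambda>t. iexp (t * u) * complex_of_real ((cmod (fourier_integral f t))\<^sup>2)"
  have scale: "(1 / k) *\<^sub>R a = b \<Longrightarrow> k \<noteq> 0 \<Longrightarrow> a = k *\<^sub>R b" for k :: real and a b :: complex
    by auto
  have "(LINT T|std_normal_distribution. ?g (c * T)) = (LINT T|lborel. std_normal_density T *\<^sub>R ?g (c * T))"
    by (rule integral_std_normal) measurable
  also have "\<dots> = (LINT T|lborel. std_normal_density ((0 + c * T) / c) *\<^sub>R ?g (0 + c * T))"
    using c by simp
  also have "\<dots> = (1 / c) *\<^sub>R (LINT t|lborel. std_normal_density (t / c) *\<^sub>R ?g t)"
    using c by (subst lborel_integral_real_affine[of c "\<lambda>t. std_normal_density (t / c) *\<^sub>R ?g t" 0]) auto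
  also have "\<dots> = (1 / (c * sqrt (2 * pi))) *\<^sub>R (LINT t|lborel. exp (- (t / c)\<^sup>2 / 2) *\<^sub>R ?g t)"
    unfolding std_normal_density_def integral_scaleR_right[symmetric]
    by (intro Bochner_Integration.integral_cong refl) simp
  finally have "(1 / (c * sqrt (2 * pi))) *\<^sub>R (LINT t|lborel. exp (- (t / c)\<^sup>2 / 2) *\<^sub>R ?g t)
     = complex_of_real (sqrt (2 * pi) / c * (LINT z|std_normal_distribution. autocorrelation f (u + z / c)))"
    unfolding integral_normal_fourier_eq_pair integral_pair_normal_eq_autocorrelation[OF c] by simp
  then have "(LINT t|lborel. exp (- (t / c)\<^sup>2 / 2) *\<^sub>R ?g t)
     = (c * sqrt (2 * pi)) *\<^sub>R complex_of_real (sqrt (2 * pi) / c * (LINT z|std_normal_distribution. autocorrelation f (u + z / c)))"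
    by (rule scale) (use c in simp)
  also have "\<dots> = complex_of_real ((c * sqrt (2 * pi)) * (sqrt (2 * pi) / c * (LINT z|std_normal_distribution. autocorrelation f (u + z / c))))"
    by (simp only: scaleR_conv_of_real of_real_mult)
  also have "(c * sqrt (2 * pi)) * (sqrt (2 * pi) / c * r) = 2 * pi * r" for r
    using c by (simp add: field_simps)
  finally show ?thesis .
qed

lemma normal_autocorrelation_tendsto:
  "(\<lambda>n. LINT z|std_normal_distribution. autocorrelation f (u + z / real (Suc n))) \<longlonglongrightarrow> autocorrelation f u"
proof -
  interpret N: real_distribution std_normal_distribution by (rule real_dist_normal_dist)
  have [measurable]: "autocorrelation f \<in> borel_measurable borel"
    unfolding autocorrelation_def by measurable
  have "(\<lambda>n. LINT z|std_normal_distribution. autocorrelation f (u + z / real (Suc n)))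
      \<longlonglongrightarrow> (LINT z|std_normal_distribution. autocorrelation f u)"
  proof (rule integral_dominated_convergence[where w = "\<lambda>_. LINT x|lborel. (f x)\<^sup>2"])
    show "AE z in std_normal_distribution.
        (\<lambda>n. autocorrelation f (u + z / real (Suc n))) \<longlonglongrightarrow> autocorrelation f u"
    proof (intro AE_I2 autocorrelation_tendsto[OF borel_measurable_integrand square])
      show "(\<lambda>n. z / real (Suc n)) \<longlonglongrightarrow> 0" for z :: real
        using LIMSEQ_Suc[OF lim_const_over_n[of z]] by simp
    qed
    show "AE z in std_normal_distribution. norm (autocorrelation f (u + z / real (Suc n)))
        \<le> (LINT x|lborel. (f x)\<^sup>2)" for n
      using autocorrelation_bounded[OF borel_measurable_integrand square] by simp
  qed auto
  then show ?thesis by (simp add: N.prob_space[simplified])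
qed

text \<open>So far the transform is only known to be bounded, which suffices under a Gaussian
  weight. The weights increase to 1, and by the identity at \<open>u = 0\<close> the weighted
  integrals converge, so monotone convergence applies. The widths \<open>Suc n\<close> satisfy the
  requirement \<open>c > 0\<close>.\<close>

lemma integrable_fourier_integral_square: "integrable lborel (\<lambda>t. (cmod (fourier_integral f t))\<^sup>2)"
proof -
  let ?h = "\<lambda>n t. exp (- (t / real (Suc n))\<^sup>2 / 2) * (cmod (fourier_integral f t))\<^sup>2"
  have int: "integrable lborel (?h n)" for n
  proof (rule Bochner_Integration.integrable_bound)
    let ?c = "real (Suc n)" and ?B = "(LINT x|lborel. \<bar>f x\<bar>)\<^sup>2"
    have "integrable lborel (\<lambda>t. std_normal_density (0 + 1 / ?c * t))"
      by (intro lborel_integrable_real_affine integrable_normal_density) auto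
    then show "integrable lborel (\<lambda>t. ?B * (sqrt (2 * pi) * std_normal_density (t / ?c)))"
      by simp
    have "(cmod (fourier_integral f t))\<^sup>2 \<le> ?B" for t
      using norm_fourier_integral_le by (intro power_mono) auto
    then have "?h n t \<le> ?B * (sqrt (2 * pi) * std_normal_density (t / ?c))" for t
      unfolding std_normal_density_def by (simp add: mult.commute[of _ "?B"] mult_right_mono)
    then show "AE t in lborel. norm (?h n t) \<le> norm (?B * (sqrt (2 * pi) * std_normal_density (t / ?c)))"
      by (intro AE_I2) (simp add: abs_mult)
  qed measurable
  have eq: "(LINT t|lborel. ?h n t)
      = 2 * pi * (LINT z|std_normal_distribution. autocorrelation f (0 + z / real (Suc n)))" for n
  proof -
    have "complex_of_real (LINT t|lborel. ?h n t)
       = (LINT t|lborel. exp (- (t / real (Suc n))\<^sup>2 / 2) *\<^sub>R (iexp (t * 0) * complex_of_real ((cmod (fourier_integral f t))\<^sup>2)))"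
      unfolding integral_complex_of_real[symmetric]
      by (intro Bochner_Integration.integral_cong refl) (simp add: scaleR_conv_of_real)
    then show ?thesis
      unfolding integral_gaussian_fourier[OF of_nat_0_less_iff[THEN iffD2, OF zero_less_Suc]] of_real_eq_iff .
  qed
  show ?thesis
  proof (rule integrable_monotone_convergence)
    show "integrable lborel (?h n)" for n by (rule int)
    show "AE t in lborel. mono (\<lambda>n. ?h n t)"
    proof (intro AE_I2 monoI mult_right_mono)
      fix t :: real and m n :: nat assume "m \<le> n"
      then have "\<bar>t / real (Suc n)\<bar> \<le> \<bar>t / real (Suc m)\<bar>"
        by (auto simp: abs_divide intro!: divide_left_mono)
      then have "(t / real (Suc n))\<^sup>2 \<le> (t / real (Suc m))\<^sup>2"
        by (rule abs_le_square_iff[THEN iffD1])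
      then show "exp (- (t / real (Suc m))\<^sup>2 / 2) \<le> exp (- (t / real (Suc n))\<^sup>2 / 2)" by simp
    qed simp
    show "AE t in lborel. (\<lambda>n. ?h n t) \<longlonglongrightarrow> (cmod (fourier_integral f t))\<^sup>2"
      using tendsto_mult_right[OF gaussian_weight_tendsto] by (intro AE_I2) (metis mult_1)
    show "(\<lambda>n. LINT t|lborel. ?h n t) \<longlonglongrightarrow> 2 * pi * autocorrelation f 0"
      unfolding eq by (intro tendsto_mult_left normal_autocorrelation_tendsto)
  qed measurable
qed

text \<open>The integrability just obtained supplies the dominating function, so the Gaussian weight
  can be removed at every \<open>u\<close>; on the other side the noise vanishes by continuity of
  the autocorrelation.\<close>

lemma fourier_integral_square_eq_autocorrelation:
  "(LINT t|lborel. iexp (t * u) * complex_of_real ((cmod (fourier_integral f t))\<^sup>2))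
    = complex_of_real (2 * pi * autocorrelation f u)"
proof (rule LIMSEQ_unique)
  let ?g = "\<lambda>t. iexp (t * u) * complex_of_real ((cmod (fourier_integral f t))\<^sup>2)"
  show "(\<lambda>n. LINT t|lborel. exp (- (t / real (Suc n))\<^sup>2 / 2) *\<^sub>R ?g t) \<longlonglongrightarrow> (LINT t|lborel. ?g t)"
  proof (rule integral_dominated_convergence[OF _ _ integrable_fourier_integral_square])
    show "AE t in lborel. (\<lambda>n. exp (- (t / real (Suc n))\<^sup>2 / 2) *\<^sub>R ?g t) \<longlonglongrightarrow> ?g t"
    proof (rule AE_I2)
      fix t :: real
      from tendsto_scaleR[OF gaussian_weight_tendsto tendsto_const]
      show "(\<lambda>n. exp (- (t / real (Suc n))\<^sup>2 / 2) *\<^sub>R ?g t) \<longlonglongrightarrow> ?g t"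
        by (rule tendsto_eq_rhs) (rule scaleR_one)
    qed
    show "AE t in lborel. norm (exp (- (t / real (Suc n))\<^sup>2 / 2) *\<^sub>R ?g t) \<le> (cmod (fourier_integral f t))\<^sup>2" for n
      by (intro AE_I2) (simp add: norm_power mult_left_le_one_le)
  qed measurable
  show "(\<lambda>n. LINT t|lborel. exp (- (t / real (Suc n))\<^sup>2 / 2) *\<^sub>R ?g t)
      \<longlonglongrightarrow> complex_of_real (2 * pi * autocorrelation f u)"
    unfolding integral_gaussian_fourier[OF of_nat_0_less_iff[THEN iffD2, OF zero_less_Suc]]
    by (intro tendsto_of_real tendsto_mult_left normal_autocorrelation_tendsto)
qed

end

section \<open>Fourier transforms in mean square\<close>

text \<open>The core of the Riesz-Fischer theorem. The rate \<open>(1 / 4) ^ j\<close> leaves room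
  for the weight \<open>2 ^ j\<close>: the weighted squared increments still have a finite total
  integral, hence a finite sum at almost every point, and the weight makes the increments themselves
  summable there.\<close>

lemma rapidly_Cauchy_AE_convergent:
  fixes F :: "nat \<Rightarrow> 'a \<Rightarrow> 'b::{banach, second_countable_topology}"
  assumes [measurable]: "\<And>n. F n \<in> borel_measurable M"
    and bound: "\<And>j. (\<integral>\<^sup>+ x. ennreal ((norm (F (Suc j) x - F j x))\<^sup>2) \<partial>M) \<le> ennreal ((1 / 4) ^ j)"
  shows "AE x in M. convergent (\<lambda>j. F j x)"
proof -
  let ?D = "\<lambda>j x. 2 ^ j * (norm (F (Suc j) x - F j x))\<^sup>2"
  have "(\<integral>\<^sup>+ x. (\<Sum>j. ennreal (?D j x)) \<partial>M) = (\<Sum>j. \<integral>\<^sup>+ x. ennreal (?D j x) \<partial>M)"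
    by (rule nn_integral_suminf) measurable
  also have "\<dots> \<le> (\<Sum>j. ennreal ((1 / 2) ^ j))"
  proof (intro suminf_le summableI)
    fix j
    have "(\<integral>\<^sup>+ x. ennreal (?D j x) \<partial>M) = ennreal (2 ^ j) * (\<integral>\<^sup>+ x. ennreal ((norm (F (Suc j) x - F j x))\<^sup>2) \<partial>M)"
      by (subst nn_integral_cmult[symmetric]) (simp_all only: ennreal_mult zero_le_power zero_le_numeral zero_le_power2, measurable)
    also have "\<dots> \<le> ennreal (2 ^ j) * ennreal ((1 / 4) ^ j)"
      by (intro mult_left_mono bound) simp
    also have "\<dots> = ennreal ((1 / 2) ^ j)"
      by (subst ennreal_mult[symmetric]) (simp_all flip: power_mult_distrib)
    finally show "(\<integral>\<^sup>+ x. ennreal (?D j x) \<partial>M) \<le> ennreal ((1 / 2) ^ j)" .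
  qed
  also have "\<dots> = ennreal (1 / (1 - 1 / 2))"
    by (intro suminf_ennreal_eq geometric_sums) auto
  finally have "(\<integral>\<^sup>+ x. (\<Sum>j. ennreal (?D j x)) \<partial>M) \<noteq> \<infinity>"
    by (auto simp: top_unique)
  then have "AE x in M. (\<Sum>j. ennreal (?D j x)) \<noteq> \<infinity>"
    by (intro nn_integral_PInf_AE) measurable
  then show ?thesis
  proof eventually_elim
    case (elim x)
    have "summable (\<lambda>j. ?D j x)"
      using elim by (intro summable_suminf_not_top) auto
    then have sum: "summable (\<lambda>j. ?D j x + (1 / 2) ^ j)"
      by (intro summable_add summable_geometric) auto
    have "norm (F (Suc j) x - F j x) \<le> ?D j x + (1 / 2) ^ j" for j
    proof -
      define y where "y = norm (F (Suc j) x - F j x)"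
      \<comment> \<open>Dividing by \<open>2 ^ j\<close> yields
        \<open>y \<le> 2 ^ j * y\<^sup>2 + (1 / 2) ^ j\<close>, which trades the norm for its
        weighted square and a geometric term.\<close>
      have "2 * (2 ^ j * y) * 1 \<le> (2 ^ j * y)\<^sup>2 + 1\<^sup>2" by (rule sum_squares_bound)
      then have "2 ^ j * y \<le> (2 ^ j * y)\<^sup>2 + 1" by (simp add: y_def) (smt (verit) mult_nonneg_nonneg norm_ge_zero zero_le_power)
      then have "(1 / 2) ^ j * (2 ^ j * y) \<le> (1 / 2) ^ j * ((2 ^ j * y)\<^sup>2 + 1)"
        by (intro mult_left_mono) auto
      then show ?thesis unfolding y_def[symmetric] by (simp add: field_simps power2_eq_square)
    qed
    then have "summable (\<lambda>j. F (Suc j) x - F j x)"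
      by (intro summable_comparison_test'[OF sum]) auto
    then have "convergent (\<lambda>n. (\<Sum>j<n. F (Suc j) x - F j x) + F 0 x)"
      by (intro convergent_add convergent_const) (simp add: summable_iff_convergent)
    then show ?case by (simp only: sum_lessThan_telescope[of "\<lambda>j. F j x"] diff_add_cancel)
  qed
qed

text \<open>Completeness in mean square. A fast subsequence converges almost everywhere, and Fatou's
  lemma along it carries the Cauchy rate \<open>a n\<close> over to the distance from the limit.
  With nonnegative integrals only differences have to be square integrable. Where the subsequence
  diverges, \<open>lim\<close> has some value on a null set.\<close>

lemma L2_Cauchy_converges:
  fixes F :: "nat \<Rightarrow> 'a \<Rightarrow> 'b::{banach, second_countable_topology}"
  assumes [measurable]: "\<And>n. F n \<in> borel_measurable M"
    and a: "a \<longlonglongrightarrow> 0"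
    and bound: "\<And>m n. n \<le> m \<Longrightarrow> (\<integral>\<^sup>+ x. ennreal ((norm (F m x - F n x))\<^sup>2) \<partial>M) \<le> ennreal (a n)"
  shows "\<exists>g\<in>borel_measurable M. \<forall>n.
    (\<integral>\<^sup>+ x. ennreal ((norm (g x - F n x))\<^sup>2) \<partial>M) \<le> ennreal (a n)"
proof -
  have "\<forall>j. \<exists>N. \<forall>n\<ge>N. a n \<le> (1 / 4) ^ j"
  proof
    fix j :: nat
    have "\<forall>\<^sub>F n in sequentially. a n < (1 / 4) ^ j"
      by (rule order_tendstoD(2)[OF a]) simp
    then show "\<exists>N. \<forall>n\<ge>N. a n \<le> (1 / 4) ^ j"
      unfolding eventually_sequentially by (meson less_imp_le)
  qed
  then obtain N where N: "\<And>j n. n \<ge> N j \<Longrightarrow> a n \<le> (1 / 4) ^ j" by metis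
  \<comment> \<open>Summing the thresholds makes \<open>k\<close> monotone and at least
    \<open>N j\<close> even if \<open>N\<close> itself is not monotone; the summand \<open>j\<close>
    makes it unbounded.\<close>
  define k where "k j = j + (\<Sum>i\<le>j. N i)" for j
  have k_mono: "k j \<le> k (Suc j)" and k_ge: "j \<le> k j" for j by (auto simp: k_def)
  have k_N: "N j \<le> k j" for j
    using member_le_sum[of j "{..j}" N] by (simp add: k_def)
  have "AE x in M. convergent (\<lambda>j. F (k j) x)"
  proof (rule rapidly_Cauchy_AE_convergent)
    fix j
    have "(\<integral>\<^sup>+ x. ennreal ((norm (F (k (Suc j)) x - F (k j) x))\<^sup>2) \<partial>M) \<le> ennreal (a (k j))"
      by (rule bound[OF k_mono])
    also have "\<dots> \<le> ennreal ((1 / 4) ^ j)" by (intro ennreal_leI N k_N)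
    finally show "(\<integral>\<^sup>+ x. ennreal ((norm (F (k (Suc j)) x - F (k j) x))\<^sup>2) \<partial>M) \<le> ennreal ((1 / 4) ^ j)" .
  qed measurable
  then have lim: "AE x in M. (\<lambda>j. F (k j) x) \<longlonglongrightarrow> lim (\<lambda>j. F (k j) x)"
    by (simp add: convergent_LIMSEQ_iff)
  show ?thesis
  proof (intro bexI allI)
    show "(\<lambda>x. lim (\<lambda>j. F (k j) x)) \<in> borel_measurable M" by measurable
    fix n
    have "(\<integral>\<^sup>+ x. ennreal ((norm (lim (\<lambda>j. F (k j) x) - F n x))\<^sup>2) \<partial>M)
        = (\<integral>\<^sup>+ x. liminf (\<lambda>j. ennreal ((norm (F (k j) x - F n x))\<^sup>2)) \<partial>M)"
      using lim
    proof (intro nn_integral_cong_AE, eventually_elim)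
      case (elim x)
      then have "(\<lambda>j. ennreal ((norm (F (k j) x - F n x))\<^sup>2))
          \<longlonglongrightarrow> ennreal ((norm (lim (\<lambda>j. F (k j) x) - F n x))\<^sup>2)"
        by (intro tendsto_intros)
      from lim_imp_Liminf[OF _ this] show ?case by simp
    qed
    also have "\<dots> \<le> liminf (\<lambda>j. \<integral>\<^sup>+ x. ennreal ((norm (F (k j) x - F n x))\<^sup>2) \<partial>M)"
      by (rule nn_integral_liminf) measurable
    also have "\<dots> \<le> ennreal (a n)"
    proof (rule Liminf_le)
      show "\<forall>\<^sub>F j in sequentially. (\<integral>\<^sup>+ x. ennreal ((norm (F (k j) x - F n x))\<^sup>2) \<partial>M) \<le> ennreal (a n)"
        using eventually_ge_at_top[of n]
        by eventually_elim (rule bound[OF order_trans[OF _ k_ge]])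
    qed simp
    finally show "(\<integral>\<^sup>+ x. ennreal ((norm (lim (\<lambda>j. F (k j) x) - F n x))\<^sup>2) \<partial>M) \<le> ennreal (a n)" .
  qed
qed

lemma norm_diff_square_le:
  fixes a b :: "'a::real_normed_vector"
  shows "(norm (a - b))\<^sup>2 \<le> 2 * ((norm a)\<^sup>2 + (norm b)\<^sup>2)"
proof -
  have "(norm (a - b))\<^sup>2 \<le> (norm a + norm b)\<^sup>2"
    using norm_triangle_ineq4[of a b] by (intro power_mono) auto
  also have "\<dots> \<le> 2 * ((norm a)\<^sup>2 + (norm b)\<^sup>2)"
    using sum_squares_bound[of "norm a" "norm b"] by (simp add: power2_sum)
  finally show ?thesis .
qed

text \<open>Made for \<open>tendsto_of_weighted_bound\<close>: it turns mean-square convergence into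
  L1 convergence of the squared moduli. With \<open>z\<close> the distance, the difference of
  squares is at most \<open>z * (2 * x + z)\<close>; Young's inequality on
  \<open>2 * (z * x)\<close> gives \<open>1 / d\<close>, and the remaining \<open>z\<^sup>2\<close>
  gives the 1.\<close>

lemma square_norm_le_weighted:
  fixes a b :: "'a::real_normed_vector"
  assumes d: "d > 0"
  shows "\<bar>(norm b)\<^sup>2 - (norm a)\<^sup>2\<bar> \<le> d * (norm a)\<^sup>2 + (1 + 1 / d) * (norm (a - b))\<^sup>2"
proof -
  define x y z where "x = norm a" and "y = norm b" and "z = norm (a - b)"
  have z: "\<bar>y - x\<bar> \<le> z" unfolding x_def y_def z_def
    by (metis norm_minus_commute norm_triangle_ineq3)
  have nn: "0 \<le> x" "0 \<le> y" "0 \<le> z" by (simp_all add: x_def y_def z_def)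
  have "\<bar>y\<^sup>2 - x\<^sup>2\<bar> = \<bar>y - x\<bar> * (y + x)"
    using nn by (simp add: power2_eq_square abs_mult[symmetric] square_diff_square_factored)
      (simp add: abs_mult)
  also have "\<dots> \<le> z * (2 * x + z)" using z nn by (intro mult_mono) auto
  also have "\<dots> = 2 * (z * x) + z\<^sup>2" by (simp add: power2_eq_square algebra_simps)
  also have "2 * (z * x) \<le> d * x\<^sup>2 + 1 / d * z\<^sup>2"
  proof -
    have "0 \<le> (sqrt d * x - z / sqrt d)\<^sup>2" by simp
    also have "\<dots> = d * x\<^sup>2 + 1 / d * z\<^sup>2 - 2 * (z * x)"
      using d by (simp add: power2_diff power_mult_distrib power_divide)
    finally show ?thesis by simp
  qed
  finally show ?thesis unfolding x_def y_def z_def by (simp add: algebra_simps)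
qed

section \<open>The autocorrelation identity for square summable functions by truncation\<close>

context
  fixes f :: "real \<Rightarrow> real"
  assumes meas[measurable]: "f \<in> borel_measurable borel"
    and square: "integrable lborel (\<lambda>x. (f x)\<^sup>2)"
begin

definition truncation :: "nat \<Rightarrow> real \<Rightarrow> real" where
  "truncation n x = indicator {- real n..real n} x * f x"

lemma borel_measurable_truncation [measurable]: "truncation n \<in> borel_measurable borel"
  unfolding truncation_def by measurable

lemma abs_truncation_le: "\<bar>truncation n x\<bar> \<le> \<bar>f x\<bar>"
  by (simp add: truncation_def indicator_def)

lemma truncation_tendsto: "(\<lambda>n. truncation n x) \<longlonglongrightarrow> f x"
proof (rule tendsto_eventually)
  obtain N :: nat where "\<bar>x\<bar> \<le> real N" using real_arch_simple by blast
  then show "\<forall>\<^sub>F n in sequentially. truncation n x = f x"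
    unfolding eventually_sequentially truncation_def
    by (intro exI[of _ N]) (auto simp: indicator_def)
qed

lemma integrable_square_dominated:
  assumes [measurable]: "g \<in> borel_measurable borel" and "\<And>x. \<bar>g x\<bar> \<le> \<bar>f x\<bar>"
  shows "integrable lborel (\<lambda>x. (g x)\<^sup>2 :: real)"
  by (rule Bochner_Integration.integrable_bound[OF square])
     (use assms in \<open>auto simp: abs_le_square_iff\<close>)

lemma integrable_truncation: "integrable lborel (truncation n)"
proof -
  have "integrable lborel (\<lambda>x. indicator {- real n..real n} x * f x)"
  proof (rule integrable_mult_square)
    have "(indicator {- real n..real n} x :: real)\<^sup>2 = indicator {- real n..real n} x" for x :: real
      by (simp add: indicator_def)
    then show "integrable lborel (\<lambda>x. (indicator {- real n..real n} x :: real)\<^sup>2)"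
      by simp
  qed (use square in measurable)
  then show ?thesis by (simp add: truncation_def[abs_def])
qed

lemma integrable_square_truncation: "integrable lborel (\<lambda>x. (truncation n x)\<^sup>2)"
  by (rule integrable_square_dominated) (auto simp: abs_truncation_le)

lemma set_integral_eq_fourier_truncation:
  "(LINT x:{- real n..real n}|lborel. iexp (t * x) * complex_of_real (f x)) = fourier_integral (truncation n) t"
  unfolding set_lebesgue_integral_def fourier_integral_def truncation_def
  by (intro Bochner_Integration.integral_cong refl) (simp add: indicator_def)

lemma abs_tail_le: "\<bar>f x - truncation n x\<bar> \<le> \<bar>f x\<bar>"
  by (simp add: truncation_def indicator_def)

lemma tail_square_tendsto: "(\<lambda>n. LINT x|lborel. (f x - truncation n x)\<^sup>2) \<longlonglongrightarrow> 0"
proof -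
  have "(\<lambda>n. LINT x|lborel. (f x - truncation n x)\<^sup>2) \<longlonglongrightarrow> (LINT x|(lborel :: real measure). 0)"
  proof (rule integral_dominated_convergence[OF _ _ square])
    have "(\<lambda>n. (f x - truncation n x)\<^sup>2) \<longlonglongrightarrow> (f x - f x)\<^sup>2" for x
      by (intro tendsto_intros truncation_tendsto)
    then show "AE x in lborel. (\<lambda>n. (f x - truncation n x)\<^sup>2) \<longlonglongrightarrow> 0" by simp
    show "AE x in lborel. norm ((f x - truncation n x)\<^sup>2) \<le> (f x)\<^sup>2" for n
      using abs_tail_le by (auto simp: abs_le_square_iff)
  qed measurable
  then show ?thesis by simp
qed

text \<open>The difference of two truncations is integrable and square summable, so the identity at
  \<open>u = 0\<close> applies to it. The bound involves only the smaller index, as a Cauchy rate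
  must.\<close>

lemma truncation_fourier_diff_square:
  assumes "n \<le> m"
  shows "(\<integral>\<^sup>+ t. ennreal ((cmod (fourier_integral (truncation m) t - fourier_integral (truncation n) t))\<^sup>2) \<partial>lborel)
    \<le> ennreal (2 * pi * (LINT x|lborel. (f x - truncation n x)\<^sup>2))"
proof -
  let ?d = "\<lambda>x. truncation m x - truncation n x"
  have d: "integrable lborel ?d" using integrable_truncation by simp
  have le: "\<bar>?d x\<bar> \<le> \<bar>f x - truncation n x\<bar>" for x
    using assms by (auto simp: truncation_def indicator_def)
  have "\<bar>?d x\<bar> \<le> \<bar>f x\<bar>" for x using le[of x] abs_tail_le[of x n] by linarith
  then have d2: "integrable lborel (\<lambda>x. (?d x)\<^sup>2)"
    by (intro integrable_square_dominated) measurable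
  have "fourier_integral (truncation m) t - fourier_integral (truncation n) t = fourier_integral ?d t" for t
    unfolding fourier_integral_def
    using integrable_fourier_integrand[OF integrable_truncation integrable_square_truncation]
    by (subst Bochner_Integration.integral_diff[symmetric]) (auto simp: right_diff_distrib)
  then have "(\<integral>\<^sup>+ t. ennreal ((cmod (fourier_integral (truncation m) t - fourier_integral (truncation n) t))\<^sup>2) \<partial>lborel)
      = ennreal (LINT t|lborel. (cmod (fourier_integral ?d t))\<^sup>2)"
    by (simp add: nn_integral_eq_integral[OF integrable_fourier_integral_square[OF d d2]])
  also have "(LINT t|lborel. (cmod (fourier_integral ?d t))\<^sup>2) = 2 * pi * autocorrelation ?d 0"
  proof -
    have "complex_of_real (LINT t|lborel. (cmod (fourier_integral ?d t))\<^sup>2)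
        = (LINT t|lborel. iexp (t * 0) * complex_of_real ((cmod (fourier_integral ?d t))\<^sup>2))"
      unfolding integral_complex_of_real[symmetric] by simp
    then show ?thesis
      unfolding fourier_integral_square_eq_autocorrelation[OF d d2] of_real_eq_iff .
  qed
  also have "ennreal \<dots> \<le> ennreal (2 * pi * (LINT x|lborel. (f x - truncation n x)\<^sup>2))"
  proof (intro ennreal_leI mult_left_mono)
    show "autocorrelation ?d 0 \<le> (LINT x|lborel. (f x - truncation n x)\<^sup>2)"
      unfolding autocorrelation_def add_0_right power2_eq_square[symmetric]
    proof (rule integral_mono[OF d2])
      show "integrable lborel (\<lambda>x. (f x - truncation n x)\<^sup>2)"
        by (rule integrable_square_dominated) (auto simp: abs_tail_le)
      show "(?d x)\<^sup>2 \<le> (f x - truncation n x)\<^sup>2" for x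
        using le by (simp add: abs_le_square_iff)
    qed
  qed simp
  finally show ?thesis .
qed

text \<open>This witness makes the choice in \<open>fourier_transform\<close> meaningful: without it
  nothing could be inferred about the chosen function.\<close>

lemma ex_L2_fourier_transform: "\<exists>g. is_L2_fourier_transform f g"
proof -
  let ?F = "\<lambda>n. fourier_integral (truncation n)"
  let ?a = "\<lambda>n. 2 * pi * (LINT x|lborel. (f x - truncation n x)\<^sup>2)"
  have a: "?a \<longlonglongrightarrow> 0" by (rule tendsto_mult_right_zero[OF tail_square_tendsto])
  have F: "?F n \<in> borel_measurable lborel" for n by measurable
  note [measurable] = F
  obtain g where [measurable]: "g \<in> borel_measurable lborel"
    and g: "\<And>n. (\<integral>\<^sup>+ t. ennreal ((cmod (g t - ?F n t))\<^sup>2) \<partial>lborel) \<le> ennreal (?a n)"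
    using L2_Cauchy_converges[OF F a truncation_fourier_diff_square] by blast
  have "(\<lambda>n. \<integral>\<^sup>+ t. ennreal ((cmod (g t - ?F n t))\<^sup>2) \<partial>lborel) \<longlonglongrightarrow> 0"
  proof (rule tendsto_sandwich[OF _ _ tendsto_const])
    show "(\<lambda>n. ennreal (?a n)) \<longlonglongrightarrow> 0"
      using tendsto_ennrealI[OF a] by simp
    show "\<forall>\<^sub>F n in sequentially. (\<integral>\<^sup>+ t. ennreal ((cmod (g t - ?F n t))\<^sup>2) \<partial>lborel) \<le> ennreal (?a n)"
      by (intro always_eventually allI g)
  qed simp
  \<comment> \<open>\<open>g\<close> lies at finite mean-square distance from the square summable
    \<open>?F 0\<close>; any other index would serve as well.\<close>
  moreover have "integrable lborel (\<lambda>t. (cmod (g t))\<^sup>2)"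
  proof (rule Bochner_Integration.integrable_bound)
    have "integrable lborel (\<lambda>t. (cmod (g t - ?F 0 t))\<^sup>2)"
    proof (rule integrableI_bounded)
      show "(\<integral>\<^sup>+ t. ennreal (norm ((cmod (g t - ?F 0 t))\<^sup>2)) \<partial>lborel) < \<infinity>"
        using order_le_less_trans[OF g[of 0]] by simp
    qed measurable
    then show "integrable lborel (\<lambda>t. 2 * ((cmod (g t - ?F 0 t))\<^sup>2 + (cmod (?F 0 t))\<^sup>2))"
      using integrable_fourier_integral_square[OF integrable_truncation integrable_square_truncation] by simp
    have "(cmod a)\<^sup>2 \<le> 2 * ((cmod (a - b))\<^sup>2 + (cmod b)\<^sup>2)" for a b :: complex
      using norm_diff_square_le[of "a - b" "- b"] by simp
    then show "AE t in lborel. norm ((cmod (g t))\<^sup>2) \<le> norm (2 * ((cmod (g t - ?F 0 t))\<^sup>2 + (cmod (?F 0 t))\<^sup>2))"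
      by (intro AE_I2) (simp add: order_trans[OF _ abs_ge_self])
  qed measurable
  moreover have "g \<in> borel_measurable borel" by measurable
  ultimately show ?thesis
    unfolding is_L2_fourier_transform_def square_summable_def set_integral_eq_fourier_truncation by blast
qed

lemma autocorrelation_truncation_tendsto:
  "(\<lambda>n. autocorrelation (truncation n) u) \<longlonglongrightarrow> autocorrelation f u"
  unfolding autocorrelation_def
proof (rule integral_dominated_convergence)
  show "integrable lborel (\<lambda>x. \<bar>f x * f (x + u)\<bar>)"
    using integrable_mult_translate[OF meas square, of 0 u] by simp
  show "AE x in lborel. (\<lambda>n. truncation n x * truncation n (x + u)) \<longlonglongrightarrow> f x * f (x + u)"
    by (intro AE_I2 tendsto_intros truncation_tendsto)
  show "AE x in lborel. norm (truncation n x * truncation n (x + u)) \<le> \<bar>f x * f (x + u)\<bar>" for n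
    by (intro AE_I2) (auto simp: abs_mult intro!: mult_mono abs_truncation_le)
qed measurable

text \<open>Valid for any version, since \<open>g\<close> enters only under the integral.
  Multiplication by a unimodular factor preserves the L1 convergence of the squared moduli, so the
  identity for truncations passes to the limit at each fixed \<open>u\<close>.\<close>

lemma L2_fourier_square_eq_autocorrelation:
  assumes g: "is_L2_fourier_transform f g"
  shows "(LINT t|lborel. iexp (t * u) * complex_of_real ((cmod (g t))\<^sup>2))
    = complex_of_real (2 * pi * autocorrelation f u)"
proof (rule LIMSEQ_unique)
  let ?F = "\<lambda>n. fourier_integral (truncation n)"
  have F2: "integrable lborel (\<lambda>t. (cmod (?F n t))\<^sup>2)" for n
    by (rule integrable_fourier_integral_square[OF integrable_truncation integrable_square_truncation])
  have [measurable]: "g \<in> borel_measurable borel" and g2: "integrable lborel (\<lambda>t. (cmod (g t))\<^sup>2)"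
    and lim: "(\<lambda>n. \<integral>\<^sup>+ t. ennreal ((cmod (g t - ?F n t))\<^sup>2) \<partial>lborel) \<longlonglongrightarrow> 0"
    using g unfolding is_L2_fourier_transform_def square_summable_def set_integral_eq_fourier_truncation by auto
  have diff: "integrable lborel (\<lambda>t. (cmod (g t - ?F n t))\<^sup>2)" for n
  proof (rule Bochner_Integration.integrable_bound)
    show "integrable lborel (\<lambda>t. 2 * ((cmod (g t))\<^sup>2 + (cmod (?F n t))\<^sup>2))"
      using g2 F2 by simp
    show "AE t in lborel. norm ((cmod (g t - ?F n t))\<^sup>2) \<le> norm (2 * ((cmod (g t))\<^sup>2 + (cmod (?F n t))\<^sup>2))"
      by (intro AE_I2) (simp add: norm_diff_square_le[unfolded distrib_left])
  qed measurable
  have b: "(\<lambda>n. LINT t|lborel. (cmod (g t - ?F n t))\<^sup>2) \<longlonglongrightarrow> 0"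
  proof (rule tendsto_ennrealD)
    show "(\<lambda>n. ennreal (LINT t|lborel. (cmod (g t - ?F n t))\<^sup>2)) \<longlonglongrightarrow> ennreal 0"
      using lim by (simp add: nn_integral_eq_integral[OF diff])
  qed simp_all
  have w: "integrable lborel (\<lambda>t. iexp (t * u) * complex_of_real ((cmod (k t))\<^sup>2))"
    if [measurable]: "k \<in> borel_measurable borel" and "integrable lborel (\<lambda>t. (cmod (k t))\<^sup>2)" for k :: "real \<Rightarrow> complex"
    by (rule Bochner_Integration.integrable_bound[OF that(2)]) (auto simp: norm_power)
  have wg: "integrable lborel (\<lambda>t. iexp (t * u) * complex_of_real ((cmod (g t))\<^sup>2))"
    by (rule w[OF _ g2]) measurable
  have wF: "integrable lborel (\<lambda>t. iexp (t * u) * complex_of_real ((cmod (?F n t))\<^sup>2))" for n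
    by (rule w[OF _ F2]) measurable
  show "(\<lambda>n. LINT t|lborel. iexp (t * u) * complex_of_real ((cmod (?F n t))\<^sup>2))
      \<longlonglongrightarrow> (LINT t|lborel. iexp (t * u) * complex_of_real ((cmod (g t))\<^sup>2))"
  proof (rule tendsto_of_weighted_bound[OF b])
    fix d :: real and n assume d: "d > 0"
    have "dist (LINT t|lborel. iexp (t * u) * complex_of_real ((cmod (?F n t))\<^sup>2))
           (LINT t|lborel. iexp (t * u) * complex_of_real ((cmod (g t))\<^sup>2))
      = cmod (LINT t|lborel. iexp (t * u) * complex_of_real ((cmod (?F n t))\<^sup>2 - (cmod (g t))\<^sup>2))"
      by (simp only: dist_norm of_real_diff right_diff_distrib Bochner_Integration.integral_diff[OF wF wg])
    also have "\<dots> \<le> (LINT t|lborel. cmod (iexp (t * u) * complex_of_real ((cmod (?F n t))\<^sup>2 - (cmod (g t))\<^sup>2)))"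
      by (rule integral_norm_bound)
    also have "\<dots> = (LINT t|lborel. \<bar>(cmod (?F n t))\<^sup>2 - (cmod (g t))\<^sup>2\<bar>)"
      by (intro Bochner_Integration.integral_cong refl) (simp del: of_real_diff)
    also have "\<dots> \<le> (LINT t|lborel. d * (cmod (g t))\<^sup>2 + (1 + 1 / d) * (cmod (g t - ?F n t))\<^sup>2)"
      by (intro integral_mono square_norm_le_weighted d integrable_abs Bochner_Integration.integrable_diff F2 g2
          Bochner_Integration.integrable_add integrable_mult_right diff)
    also have "\<dots> = d * (LINT t|lborel. (cmod (g t))\<^sup>2) + (1 + 1 / d) * (LINT t|lborel. (cmod (g t - ?F n t))\<^sup>2)"
      using g2 diff by simp
    finally show "dist (LINT t|lborel. iexp (t * u) * complex_of_real ((cmod (?F n t))\<^sup>2))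
           (LINT t|lborel. iexp (t * u) * complex_of_real ((cmod (g t))\<^sup>2))
      \<le> d * (LINT t|lborel. (cmod (g t))\<^sup>2) + (1 + 1 / d) * (LINT t|lborel. (cmod (g t - ?F n t))\<^sup>2)" .
  qed
  show "(\<lambda>n. LINT t|lborel. iexp (t * u) * complex_of_real ((cmod (?F n t))\<^sup>2))
      \<longlonglongrightarrow> complex_of_real (2 * pi * autocorrelation f u)"
    unfolding fourier_integral_square_eq_autocorrelation[OF integrable_truncation integrable_square_truncation]
    by (intro tendsto_of_real tendsto_mult_left autocorrelation_truncation_tendsto)
qed

end

text \<open>Merges the two branches of \<open>fourier_transform\<close>. These three facts are all
  that the multivariate part uses about the transform.\<close>

lemma fourier_transform_autocorrelation:
  assumes f: "square_summable f"
  shows "fourier_transform f \<in> borel_measurable borel" (is ?meas)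
    and "integrable lborel (\<lambda>t. (cmod (fourier_transform f t))\<^sup>2)" (is ?int)
    and "(LINT t|lborel. iexp (t * u) * complex_of_real ((cmod (fourier_transform f t))\<^sup>2))
      = complex_of_real (2 * pi * autocorrelation f u)" (is ?eq)
proof -
  have meas: "f \<in> borel_measurable borel" and square: "integrable lborel (\<lambda>x. (f x)\<^sup>2)"
    using f by (auto simp: square_summable_def)
  have "?meas \<and> ?int \<and> ?eq"
  proof (cases "integrable lborel f")
    case True
    then have "fourier_transform f = fourier_integral f"
      by (simp add: fourier_transform_def fourier_integral_def fun_eq_iff)
    then show ?thesis
      using borel_measurable_fourier_integral[OF meas]
        integrable_fourier_integral_square[OF True square]
        fourier_integral_square_eq_autocorrelation[OF True square] by simp
  next
    case False
    then have "fourier_transform f = (SOME g. is_L2_fourier_transform f g)"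
      by (simp add: fourier_transform_def)
    then have "is_L2_fourier_transform f (fourier_transform f)"
      using someI_ex[OF ex_L2_fourier_transform[OF meas square]] by simp
    then show ?thesis
      using L2_fourier_square_eq_autocorrelation[OF meas square]
      unfolding is_L2_fourier_transform_def square_summable_def by blast
  qed
  then show ?meas ?int ?eq by blast+
qed

section \<open>Smoothing the law of a random vector by product kernels\<close>

text \<open>
  The kernel \<open>\<kappa> k y x\<close> stands for \<open>f (y - x / \<sigma> k)\<close> and the weight \<open>p k t\<close> for \<open>\<sigma> k |\<psi> (\<sigma> k t)|\<^sup>2 / (2 pi)\<close>,
  where \<open>\<psi>\<close> is the Fourier transform of \<open>f\<close>.
\<close>

locale smoothing_kernels =
  fixes I :: "'i set" and \<kappa> :: "'i \<Rightarrow> real \<Rightarrow> real \<Rightarrow> real" and p :: "'i \<Rightarrow> real \<Rightarrow> real"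
  assumes finite_I: "finite I"
    and kernel_measurable: "\<And>k. k \<in> I \<Longrightarrow> case_prod (\<kappa> k) \<in> borel_measurable (borel \<Otimes>\<^sub>M borel)"
    and kernel_square: "\<And>k x. k \<in> I \<Longrightarrow> integrable lborel (\<lambda>y. (\<kappa> k y x)\<^sup>2)"
    and weight_integrable: "\<And>k. k \<in> I \<Longrightarrow> integrable lborel (p k)"
    and weight_nonneg: "\<And>k t. k \<in> I \<Longrightarrow> 0 \<le> p k t"
    and kernel_correlation: "\<And>k x w. k \<in> I \<Longrightarrow> complex_of_real (LINT y|lborel. \<kappa> k y x * \<kappa> k y w)
        = (LINT t|lborel. iexp (t * (x - w)) * complex_of_real (p k t))"
begin

abbreviation L :: "('i \<Rightarrow> real) measure" where
  "L \<equiv> Pi\<^sub>M I (\<lambda>_. lborel)"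

sublocale lborels: finite_product_sigma_finite "\<lambda>_::'i. lborel :: real measure" I
  by (unfold_locales) (rule finite_I)

lemma kernel_comp_measurable [measurable (raw)]:
  assumes "k \<in> I" and [measurable]: "A \<in> borel_measurable N" "B \<in> borel_measurable N"
  shows "(\<lambda>z. \<kappa> k (A z) (B z)) \<in> borel_measurable N"
proof -
  have "(\<lambda>z. (A z, B z)) \<in> measurable N (borel \<Otimes>\<^sub>M borel)" by measurable
  from measurable_compose[OF this kernel_measurable[OF assms(1)]] show ?thesis by simp
qed

lemma weight_measurable [measurable (raw)]:
  assumes "k \<in> I" and A: "A \<in> borel_measurable N"
  shows "(\<lambda>z. p k (A z)) \<in> borel_measurable N"
  using measurable_compose[OF A, of "p k" borel] borel_measurable_integrable[OF weight_integrable[OF assms(1)]]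
  by simp

text \<open>The correlation identity on the diagonal: the norm does not depend on \<open>x\<close>,
  which makes the bounds below uniform over the values of a random vector.\<close>

lemma kernel_square_integral:
  assumes "k \<in> I" shows "(LINT y|lborel. (\<kappa> k y x)\<^sup>2) = (LINT t|lborel. p k t)"
proof -
  have "complex_of_real (LINT y|lborel. (\<kappa> k y x)\<^sup>2) = (LINT t|lborel. complex_of_real (p k t))"
    using kernel_correlation[OF assms, of x x] by (simp add: power2_eq_square)
  then show ?thesis by (simp only: integral_complex_of_real of_real_eq_iff)
qed

lemma kernel_product_integrable:
  assumes "k \<in> I" shows "integrable lborel (\<lambda>y. \<kappa> k y x * \<kappa> k y w)"
  using assms by (intro integrable_mult_square kernel_square) auto

lemma kernel_product_nn_integral_le:
  assumes k: "k \<in> I"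
  shows "(\<integral>\<^sup>+ y. ennreal \<bar>\<kappa> k y x * \<kappa> k y w\<bar> \<partial>lborel) \<le> ennreal (LINT t|lborel. p k t)"
proof -
  have "(\<integral>\<^sup>+ y. ennreal \<bar>\<kappa> k y x * \<kappa> k y w\<bar> \<partial>lborel) = ennreal (LINT y|lborel. \<bar>\<kappa> k y x * \<kappa> k y w\<bar>)"
    using kernel_product_integrable[OF k] by (intro nn_integral_eq_integral) auto
  also have "\<dots> \<le> ennreal (LINT y|lborel. ((\<kappa> k y x)\<^sup>2 + (\<kappa> k y w)\<^sup>2) / 2)"
  proof (intro ennreal_leI integral_mono)
    show "integrable lborel (\<lambda>y. \<bar>\<kappa> k y x * \<kappa> k y w\<bar>)"
      using kernel_product_integrable[OF k] by simp
    show "\<bar>\<kappa> k y x * \<kappa> k y w\<bar> \<le> ((\<kappa> k y x)\<^sup>2 + (\<kappa> k y w)\<^sup>2) / 2" for y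
      using sum_squares_bound[of "\<bar>\<kappa> k y x\<bar>" "\<bar>\<kappa> k y w\<bar>"] by (simp add: abs_mult)
  qed (use kernel_square[OF k] in simp)
  also have "(LINT y|lborel. ((\<kappa> k y x)\<^sup>2 + (\<kappa> k y w)\<^sup>2) / 2) = (LINT t|lborel. p k t)"
    using kernel_square[OF k] kernel_square_integral[OF k] by simp
  finally show ?thesis .
qed

lemma weight_prod_integrable: "integrable L (\<lambda>t. \<Prod>k\<in>I. p k (t k))"
  by (intro lborels.product_integrable_prod finite_I weight_integrable)

lemma prod_iexp: "(\<Prod>k\<in>I. iexp (t k * (a k - b k)) * complex_of_real (p k (t k)))
    = iexp (\<Sum>k\<in>I. t k * (a k - b k)) * complex_of_real (\<Prod>k\<in>I. p k (t k))"
  by (simp add: prod.distrib exp_sum[OF finite_I] sum_distrib_left)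

section \<open>Exchanging smoothing and expectation for a pair of vectors\<close>

context
  fixes \<Omega> :: "'a measure" and U V :: "'i \<Rightarrow> 'a \<Rightarrow> real"
  assumes prob: "prob_space \<Omega>"
    and U [measurable]: "\<And>k. k \<in> I \<Longrightarrow> U k \<in> borel_measurable \<Omega>"
    and V [measurable]: "\<And>k. k \<in> I \<Longrightarrow> V k \<in> borel_measurable \<Omega>"
begin

interpretation \<Omega>: prob_space \<Omega> by (rule prob)
interpretation L\<Omega>: pair_sigma_finite L \<Omega> ..

text \<open>Tonelli with \<open>y\<close> innermost: for fixed outcomes the integral over
  \<open>y\<close> factors, and each factor is at most the constant
  \<open>LINT t|lborel. p k t\<close>.\<close>

lemma kernel_pair_integrable:
  "integrable (L \<Otimes>\<^sub>M \<Omega>) (\<lambda>(y, \<omega>). (\<Prod>k\<in>I. \<kappa> k (y k) (U k \<omega>) * \<kappa> k (y k) (V k \<omega>)))"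
    (is "integrable _ ?f")
proof (rule integrableI_bounded)
  show [measurable]: "?f \<in> borel_measurable (L \<Otimes>\<^sub>M \<Omega>)" by measurable
  have "(\<integral>\<^sup>+ z. ennreal (norm (?f z)) \<partial>(L \<Otimes>\<^sub>M \<Omega>)) = (\<integral>\<^sup>+ \<omega>. \<integral>\<^sup>+ y. ennreal (norm (?f (y, \<omega>))) \<partial>L \<partial>\<Omega>)"
    by (rule L\<Omega>.nn_integral_snd[symmetric]) measurable
  also have "\<dots> \<le> (\<integral>\<^sup>+ \<omega>. (\<Prod>k\<in>I. ennreal (LINT t|lborel. p k t)) \<partial>\<Omega>)"
  proof (rule nn_integral_mono)
    fix \<omega>
    have "(\<integral>\<^sup>+ y. ennreal (norm (?f (y, \<omega>))) \<partial>L)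
        = (\<integral>\<^sup>+ y. (\<Prod>k\<in>I. ennreal \<bar>\<kappa> k (y k) (U k \<omega>) * \<kappa> k (y k) (V k \<omega>)\<bar>) \<partial>L)"
      by (simp add: abs_prod prod_ennreal)
    also have "\<dots> = (\<Prod>k\<in>I. \<integral>\<^sup>+ y. ennreal \<bar>\<kappa> k y (U k \<omega>) * \<kappa> k y (V k \<omega>)\<bar> \<partial>lborel)"
      using borel_measurable_integrable[OF kernel_product_integrable]
      by (intro lborels.product_nn_integral_prod finite_I) simp
    also have "\<dots> \<le> (\<Prod>k\<in>I. ennreal (LINT t|lborel. p k t))"
      by (intro prod_mono_ennreal kernel_product_nn_integral_le)
    finally show "(\<integral>\<^sup>+ y. ennreal (norm (?f (y, \<omega>))) \<partial>L) \<le> (\<Prod>k\<in>I. ennreal (LINT t|lborel. p k t))" .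
  qed
  also have "\<dots> < \<infinity>"
    by (simp add: \<Omega>.emeasure_space_1 less_top[symmetric] ennreal_prod_eq_top)
  finally show "(\<integral>\<^sup>+ z. ennreal (norm (?f z)) \<partial>(L \<Otimes>\<^sub>M \<Omega>)) < \<infinity>" .
qed

text \<open>For a fixed outcome both sides are products of one-dimensional integrals, equal factor
  by factor by \<open>kernel_correlation\<close>. Fubini is applied once on each side, with the
  integrable product of the weights as the bound on the frequency side.\<close>

lemma kernel_pair_integral:
  "complex_of_real (LINT y|L. LINT \<omega>|\<Omega>. (\<Prod>k\<in>I. \<kappa> k (y k) (U k \<omega>) * \<kappa> k (y k) (V k \<omega>)))
    = (LINT t|L. complex_of_real (\<Prod>k\<in>I. p k (t k)) * (LINT \<omega>|\<Omega>. iexp (\<Sum>k\<in>I. t k * (U k \<omega> - V k \<omega>))))"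
proof -
  let ?G = "\<lambda>t \<omega>. iexp (\<Sum>k\<in>I. t k * (U k \<omega> - V k \<omega>)) * complex_of_real (\<Prod>k\<in>I. p k (t k))"
  have int: "integrable (L \<Otimes>\<^sub>M \<Omega>) (case_prod ?G)"
  proof (rule L\<Omega>.integrable_product_bound[where h = "\<lambda>_. 1", OF _ weight_prod_integrable])
    show "cmod (case_prod ?G (t, \<omega>)) \<le> (\<Prod>k\<in>I. p k (t k)) * 1" for t \<omega>
    proof -
      have "cmod (case_prod ?G (t, \<omega>)) = \<bar>\<Prod>k\<in>I. p k (t k)\<bar>"
        unfolding prod.case by (subst norm_exp_ii_mult) (simp_all only: Im_complex_of_real norm_of_real)
      then show ?thesis using weight_nonneg by (simp add: prod_nonneg)
    qed
  qed auto
  have "complex_of_real (LINT y|L. LINT \<omega>|\<Omega>. (\<Prod>k\<in>I. \<kappa> k (y k) (U k \<omega>) * \<kappa> k (y k) (V k \<omega>)))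
      = complex_of_real (LINT \<omega>|\<Omega>. LINT y|L. (\<Prod>k\<in>I. \<kappa> k (y k) (U k \<omega>) * \<kappa> k (y k) (V k \<omega>)))"
    using L\<Omega>.Fubini_integral[OF kernel_pair_integrable] by simp
  also have "\<dots> = (LINT \<omega>|\<Omega>. complex_of_real (LINT y|L. (\<Prod>k\<in>I. \<kappa> k (y k) (U k \<omega>) * \<kappa> k (y k) (V k \<omega>))))"
    by (rule integral_complex_of_real[symmetric])
  also have "\<dots> = (LINT \<omega>|\<Omega>. LINT t|L. ?G t \<omega>)"
  proof (rule Bochner_Integration.integral_cong[OF refl])
    fix \<omega>
    have iw: "integrable lborel (\<lambda>t. iexp (t * v) * complex_of_real (p k t))" if "k \<in> I" for k v
      by (rule Bochner_Integration.integrable_bound[OF weight_integrable[OF that]]) (use that in auto)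
    have "complex_of_real (LINT y|L. (\<Prod>k\<in>I. \<kappa> k (y k) (U k \<omega>) * \<kappa> k (y k) (V k \<omega>)))
        = (\<Prod>k\<in>I. complex_of_real (LINT y|lborel. \<kappa> k y (U k \<omega>) * \<kappa> k y (V k \<omega>)))"
      using lborels.product_integral_prod[OF finite_I kernel_product_integrable] by simp
    also have "\<dots> = (\<Prod>k\<in>I. LINT t|lborel. iexp (t * (U k \<omega> - V k \<omega>)) * complex_of_real (p k t))"
      by (intro prod.cong refl kernel_correlation)
    also have "\<dots> = (LINT t|L. (\<Prod>k\<in>I. iexp (t k * (U k \<omega> - V k \<omega>)) * complex_of_real (p k (t k))))"
      by (rule lborels.product_integral_prod[OF finite_I iw, symmetric])
    finally show "complex_of_real (LINT y|L. (\<Prod>k\<in>I. \<kappa> k (y k) (U k \<omega>) * \<kappa> k (y k) (V k \<omega>))) = (LINT t|L. ?G t \<omega>)"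
      unfolding prod_iexp .
  qed
  also have "\<dots> = (LINT t|L. LINT \<omega>|\<Omega>. ?G t \<omega>)"
    by (rule L\<Omega>.Fubini_integral[OF int])
  finally show ?thesis by (simp add: mult.commute)
qed

end

text \<open>For \<open>\<kappa> k y x = f (y - x / s k)\<close> with \<open>f\<close> a probability
  density this is the density of the rescaled vector after adding independent noise with density
  \<open>f\<close> in each component; for a general kernel the name is only suggestive.\<close>

definition smoothed_density :: "'a measure \<Rightarrow> ('i \<Rightarrow> 'a \<Rightarrow> real) \<Rightarrow> ('i \<Rightarrow> real) \<Rightarrow> real" where
  "smoothed_density N X y = (LINT \<omega>|N. (\<Prod>k\<in>I. \<kappa> k (y k) (X k \<omega>)))"

definition vector_char :: "'a measure \<Rightarrow> ('i \<Rightarrow> 'a \<Rightarrow> real) \<Rightarrow> ('i \<Rightarrow> real) \<Rightarrow> complex" where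
  "vector_char N X t = (LINT \<omega>|N. iexp (\<Sum>k\<in>I. t k * X k \<omega>))"

lemma smoothed_density_measurable:
  assumes "prob_space N" and [measurable]: "\<And>k. k \<in> I \<Longrightarrow> X k \<in> borel_measurable N"
  shows "smoothed_density N X \<in> borel_measurable L"
proof -
  interpret prob_space N by fact
  show ?thesis unfolding smoothed_density_def by measurable
qed

lemma vector_char_measurable:
  assumes "prob_space N" and [measurable]: "\<And>k. k \<in> I \<Longrightarrow> X k \<in> borel_measurable N"
  shows "vector_char N X \<in> borel_measurable L"
proof -
  interpret prob_space N by fact
  show ?thesis unfolding vector_char_def by measurable
qed

lemma norm_vector_char_le:
  assumes "prob_space N"
  shows "cmod (vector_char N X t) \<le> 1"
proof -
  interpret prob_space N by fact
  have "cmod (vector_char N X t) \<le> (LINT \<omega>|N. cmod (iexp (\<Sum>k\<in>I. t k * X k \<omega>)))"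
    unfolding vector_char_def by (rule integral_norm_bound)
  then show ?thesis by (simp only: norm_exp_i_times) (simp add: prob_space)
qed

section \<open>Inner products of two smoothed densities\<close>

context
  fixes M :: "'a measure" and N :: "'b measure" and X :: "'i \<Rightarrow> 'a \<Rightarrow> real" and W :: "'i \<Rightarrow> 'b \<Rightarrow> real"
  assumes probM: "prob_space M" and probN: "prob_space N"
    and X [measurable]: "\<And>k. k \<in> I \<Longrightarrow> X k \<in> borel_measurable M"
    and W [measurable]: "\<And>k. k \<in> I \<Longrightarrow> W k \<in> borel_measurable N"
begin

interpretation M: prob_space M by (rule probM)
interpretation N: prob_space N by (rule probN)
interpretation MN: pair_prob_space M N ..
interpretation LMN: pair_sigma_finite L "M \<Otimes>\<^sub>M N" ..

lemma kernel_product_pair_integrable: "integrable (L \<Otimes>\<^sub>M (M \<Otimes>\<^sub>M N))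
    (\<lambda>(y, \<omega>). (\<Prod>k\<in>I. \<kappa> k (y k) (X k (fst \<omega>)) * \<kappa> k (y k) (W k (snd \<omega>))))"
  by (rule kernel_pair_integrable[OF MN.prob_space_axioms]; measurable)

text \<open>A product of two expectations is one expectation over independent copies. Evaluating the
  latter as an iterated integral requires integrability at the given \<open>y\<close>, which Fubini
  grants for almost every \<open>y\<close>.\<close>

lemma smoothed_density_mult_AE:
  "AE y in L. smoothed_density M X y * smoothed_density N W y
    = (LINT \<omega>|(M \<Otimes>\<^sub>M N). (\<Prod>k\<in>I. \<kappa> k (y k) (X k (fst \<omega>)) * \<kappa> k (y k) (W k (snd \<omega>))))"
proof -
  from LMN.AE_integrable_fst[OF kernel_product_pair_integrable] show ?thesis
  proof eventually_elim
    case (elim y)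
    have "smoothed_density M X y * smoothed_density N W y
        = (LINT \<omega>|M. LINT \<omega>'|N. (\<Prod>k\<in>I. \<kappa> k (y k) (X k \<omega>) * \<kappa> k (y k) (W k \<omega>')))"
      by (simp add: smoothed_density_def prod.distrib)
    also have "\<dots> = (LINT \<omega>|(M \<Otimes>\<^sub>M N). (\<Prod>k\<in>I. \<kappa> k (y k) (X k (fst \<omega>)) * \<kappa> k (y k) (W k (snd \<omega>))))"
      using MN.integral_fst'[OF elim] by simp
    finally show ?case .
  qed
qed

lemma vector_char_mult_cnj:
  "vector_char M X t * cnj (vector_char N W t)
    = (LINT \<omega>|(M \<Otimes>\<^sub>M N). iexp (\<Sum>k\<in>I. t k * (X k (fst \<omega>) - W k (snd \<omega>))))"
proof -
  have int: "integrable (M \<Otimes>\<^sub>M N) (\<lambda>\<omega>. iexp (\<Sum>k\<in>I. t k * (X k (fst \<omega>) - W k (snd \<omega>))))"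
    by (rule MN.P.integrable_const_bound[where B = 1]) (simp_all only: norm_exp_i_times, auto)
  have "vector_char M X t * cnj (vector_char N W t)
      = (LINT \<omega>|M. LINT \<omega>'|N. iexp (\<Sum>k\<in>I. t k * X k \<omega>) * cnj (iexp (\<Sum>k\<in>I. t k * W k \<omega>')))"
    unfolding vector_char_def by simp
  also have "\<dots> = (LINT \<omega>|M. LINT \<omega>'|N. iexp (\<Sum>k\<in>I. t k * (X k \<omega> - W k \<omega>')))"
    by (intro Bochner_Integration.integral_cong refl)
       (simp add: exp_cnj exp_minus exp_diff right_diff_distrib sum_subtractf divide_inverse)
  also have "\<dots> = (LINT \<omega>|(M \<Otimes>\<^sub>M N). iexp (\<Sum>k\<in>I. t k * (X k (fst \<omega>) - W k (snd \<omega>))))"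
    using MN.integral_fst'[OF int] by simp
  finally show ?thesis .
qed

lemma smoothed_density_mult_measurable:
  "(\<lambda>y. smoothed_density M X y * smoothed_density N W y) \<in> borel_measurable L"
  by (intro borel_measurable_times smoothed_density_measurable probM probN X W)

lemma smoothed_density_mult_integrable:
  "integrable L (\<lambda>y. smoothed_density M X y * smoothed_density N W y)"
proof (rule integrable_cong_AE_imp[OF LMN.integrable_fst[OF kernel_product_pair_integrable]])
  show "AE y in L. (LINT \<omega>|(M \<Otimes>\<^sub>M N). (\<Prod>k\<in>I. \<kappa> k (y k) (X k (fst \<omega>)) * \<kappa> k (y k) (W k (snd \<omega>))))
      = smoothed_density M X y * smoothed_density N W y"
    using smoothed_density_mult_AE by eventually_elim simp
qed (rule smoothed_density_mult_measurable)

lemma smoothed_density_mult_integral: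
  "complex_of_real (LINT y|L. smoothed_density M X y * smoothed_density N W y)
    = (LINT t|L. complex_of_real (\<Prod>k\<in>I. p k (t k)) * (vector_char M X t * cnj (vector_char N W t)))"
proof -
  have "(LINT y|L. smoothed_density M X y * smoothed_density N W y)
      = (LINT y|L. LINT \<omega>|(M \<Otimes>\<^sub>M N). (\<Prod>k\<in>I. \<kappa> k (y k) (X k (fst \<omega>)) * \<kappa> k (y k) (W k (snd \<omega>))))"
    by (rule integral_cong_AE[OF smoothed_density_mult_measurable _ smoothed_density_mult_AE])
       (rule borel_measurable_integrable[OF LMN.integrable_fst[OF kernel_product_pair_integrable]])
  then show ?thesis
    unfolding vector_char_mult_cnj
    by (simp only:) (rule kernel_pair_integral[OF MN.prob_space_axioms]; measurable)
qed

end

end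

context smoothing_kernels
begin

text \<open>Each of the four products in either square is integrable on its own, so both expansions
  split and match term by term. Two spaces appear because the comparison vector will live on the
  product of the marginal laws.\<close>

lemma smoothed_density_diff_square:
  fixes M :: "'a measure" and N :: "'b measure"
  assumes M: "prob_space M" and N: "prob_space N"
    and X: "\<And>k. k \<in> I \<Longrightarrow> X k \<in> borel_measurable M"
    and W: "\<And>k. k \<in> I \<Longrightarrow> W k \<in> borel_measurable N"
  shows "(LINT y|L. (smoothed_density M X y - smoothed_density N W y)\<^sup>2)
    = (LINT t|L. (\<Prod>k\<in>I. p k (t k)) * (cmod (vector_char M X t - vector_char N W t))\<^sup>2)"
proof -
  let ?A = "smoothed_density M X" and ?B = "smoothed_density N W"
  let ?a = "vector_char M X" and ?b = "vector_char N W"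
  let ?P = "\<lambda>t. complex_of_real (\<Prod>k\<in>I. p k (t k))"
  note AA = M M X X and AB = M N X W and BA = N M W X and BB = N N W W
  have char_int: "integrable L (\<lambda>t. ?P t * (u t * cnj (v t)))"
    if [measurable]: "u \<in> borel_measurable L" "v \<in> borel_measurable L"
      and "\<And>t. cmod (u t) \<le> 1" "\<And>t. cmod (v t) \<le> 1" for u v
  proof (rule Bochner_Integration.integrable_bound[OF weight_prod_integrable])
    have [measurable]: "(\<lambda>t. cnj (v t)) \<in> borel_measurable L"
      by (rule measurable_compose[OF that(2) borel_measurable_continuous_onI])
         (intro continuous_intros)
    have "cmod (?P t) * (cmod (u t) * cmod (v t)) \<le> cmod (?P t) * (1 * 1)" for t
      by (intro mult_left_mono mult_mono that) auto
    then show "AE t in L. cmod (?P t * (u t * cnj (v t))) \<le> norm (\<Prod>k\<in>I. p k (t k))"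
      by (simp add: norm_mult del: of_real_prod)
    show "(\<lambda>t. ?P t * (u t * cnj (v t))) \<in> borel_measurable L" by measurable
  qed
  note a = vector_char_measurable[OF M X] norm_vector_char_le[OF M, of X]
    and b = vector_char_measurable[OF N W] norm_vector_char_le[OF N, of W]
  note ints = char_int[OF a(1) a(1) a(2) a(2)] char_int[OF a(1) b(1) a(2) b(2)]
    char_int[OF b(1) a(1) b(2) a(2)] char_int[OF b(1) b(1) b(2) b(2)]
  have "(LINT y|L. (?A y - ?B y)\<^sup>2) = (LINT y|L. ?A y * ?A y - ?A y * ?B y - ?B y * ?A y + ?B y * ?B y)"
    by (intro Bochner_Integration.integral_cong refl) (simp add: power2_eq_square algebra_simps)
  also have "\<dots> = (LINT y|L. ?A y * ?A y) - (LINT y|L. ?A y * ?B y) - (LINT y|L. ?B y * ?A y) + (LINT y|L. ?B y * ?B y)"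
    by (simp only: Bochner_Integration.integral_add Bochner_Integration.integral_diff
        Bochner_Integration.integrable_diff smoothed_density_mult_integrable[OF AA]
        smoothed_density_mult_integrable[OF AB] smoothed_density_mult_integrable[OF BA]
        smoothed_density_mult_integrable[OF BB])
  finally have "complex_of_real (LINT y|L. (?A y - ?B y)\<^sup>2)
      = (LINT t|L. ?P t * (?a t * cnj (?a t))) - (LINT t|L. ?P t * (?a t * cnj (?b t)))
        - (LINT t|L. ?P t * (?b t * cnj (?a t))) + (LINT t|L. ?P t * (?b t * cnj (?b t)))"
    by (simp only: of_real_add of_real_diff smoothed_density_mult_integral[OF AA]
        smoothed_density_mult_integral[OF AB] smoothed_density_mult_integral[OF BA]
        smoothed_density_mult_integral[OF BB])
  also have "\<dots> = (LINT t|L. ?P t * (?a t * cnj (?a t)) - ?P t * (?a t * cnj (?b t))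
        - ?P t * (?b t * cnj (?a t)) + ?P t * (?b t * cnj (?b t)))"
    by (simp only: Bochner_Integration.integral_add Bochner_Integration.integral_diff
        Bochner_Integration.integrable_diff ints)
  also have "\<dots> = (LINT t|L. complex_of_real ((\<Prod>k\<in>I. p k (t k)) * (cmod (?a t - ?b t))\<^sup>2))"
    by (intro Bochner_Integration.integral_cong refl)
       (simp only: of_real_mult complex_norm_square complex_cnj_diff algebra_simps)
  finally show ?thesis
    unfolding integral_complex_of_real of_real_eq_iff .
qed

text \<open>The cylinder over a null set has a zero factor in its measure, and zero times the
  infinite measure of the other factors is zero in \<open>ennreal\<close>.\<close>

lemma AE_component:
  assumes k: "k \<in> I" and "AE x in lborel. P x"
  shows "AE y in L. P (y k)"
proof -
  obtain N where N: "{x. \<not> P x} \<subseteq> N" "emeasure lborel N = 0" "N \<in> sets lborel"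
    using AE_E[OF assms(2)] by auto
  let ?A = "Pi\<^sub>E I (\<lambda>j. if j = k then N else UNIV)"
  have sets: "(if j = k then N else UNIV) \<in> sets lborel" for j using N(3) by simp
  show ?thesis
  proof (rule AE_I)
    show "{y \<in> space L. \<not> P (y k)} \<subseteq> ?A"
      using N(1) by (auto simp: space_PiM PiE_iff extensional_def)
    show "?A \<in> sets L" by (intro sets_PiM_I_finite finite_I sets)
    have "emeasure L ?A = (\<Prod>j\<in>I. emeasure lborel (if j = k then N else UNIV))"
      by (intro lborels.measure_times sets)
    also have "\<dots> = 0" using k N(2) finite_I by (intro prod_zero) auto
    finally show "emeasure L ?A = 0" .
  qed
qed

section \<open>Comparison with the vector of independent components\<close>

context
  fixes M :: "'a measure" and X :: "'i \<Rightarrow> 'a \<Rightarrow> real"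
  assumes prob: "prob_space M" and X [measurable]: "\<And>k. k \<in> I \<Longrightarrow> X k \<in> borel_measurable M"
begin

interpretation M: prob_space M by (rule prob)

text \<open>By Tonelli the expected square is integrable in \<open>y\<close> with total
  \<open>LINT t|lborel. p k t\<close>. So for almost every \<open>y\<close> the second moment is
  finite, and on a probability space this gives a finite first moment.\<close>

lemma kernel_integrable_AE:
  assumes [measurable]: "k \<in> I"
  shows "AE y in lborel. integrable M (\<lambda>\<omega>. \<kappa> k y (X k \<omega>))"
proof -
  interpret LM: pair_sigma_finite "lborel :: real measure" M ..
  have "integrable (lborel \<Otimes>\<^sub>M M) (\<lambda>(y, \<omega>). (\<kappa> k y (X k \<omega>))\<^sup>2)"
  proof (rule integrableI_bounded)
    have "(\<integral>\<^sup>+ z. ennreal (norm (case z of (y, \<omega>) \<Rightarrow> (\<kappa> k y (X k \<omega>))\<^sup>2)) \<partial>(lborel \<Otimes>\<^sub>M M))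
        = (\<integral>\<^sup>+ \<omega>. \<integral>\<^sup>+ y. ennreal ((\<kappa> k y (X k \<omega>))\<^sup>2) \<partial>lborel \<partial>M)"
      by (subst LM.nn_integral_snd[symmetric]) auto
    also have "\<dots> = (\<integral>\<^sup>+ \<omega>. ennreal (LINT t|lborel. p k t) \<partial>M)"
      using nn_integral_eq_integral[OF kernel_square[OF assms]]
      by (simp add: kernel_square_integral[OF assms])
    also have "\<dots> < \<infinity>" by (simp add: M.emeasure_space_1)
    finally show "(\<integral>\<^sup>+ z. ennreal (norm (case z of (y, \<omega>) \<Rightarrow> (\<kappa> k y (X k \<omega>))\<^sup>2)) \<partial>(lborel \<Otimes>\<^sub>M M)) < \<infinity>" .
  qed measurable
  from LM.AE_integrable_fst[OF this] show ?thesis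
  proof eventually_elim
    case (elim y)
    show ?case by (rule M.square_integrable_imp_integrable[OF _ elim]) measurable
  qed
qed

text \<open>Outside \<open>I\<close> it is the point mass at 0: the locale
  \<open>product_prob_space\<close> asks for a probability measure at every index.\<close>

definition marginal_law :: "'i \<Rightarrow> real measure" where
  "marginal_law k = distr M borel (if k \<in> I then X k else (\<lambda>_. 0))"

lemma marginal_law_eq: "k \<in> I \<Longrightarrow> marginal_law k = distr M borel (X k)"
  by (simp add: marginal_law_def)

lemma sets_marginal_law [measurable_cong]: "sets (marginal_law k) = sets borel"
  by (simp add: marginal_law_def)

lemma prob_space_marginal_law: "prob_space (marginal_law k)"
  unfolding marginal_law_def by (rule M.prob_space_distr) auto

interpretation Q: product_prob_space marginal_law I
  by (intro product_prob_spaceI prob_space_marginal_law)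

interpretation Q: finite_product_sigma_finite marginal_law I
  by unfold_locales (rule finite_I)

lemma prob_space_marginals: "prob_space (Pi\<^sub>M I marginal_law)"
  by (rule Q.prob_space_axioms)

lemma coordinate_measurable: "k \<in> I \<Longrightarrow> (\<lambda>\<omega>. \<omega> k) \<in> borel_measurable (Pi\<^sub>M I marginal_law)"
  by measurable

lemma smoothed_density_marginals_AE:
  "AE y in L. smoothed_density (Pi\<^sub>M I marginal_law) (\<lambda>k \<omega>. \<omega> k) y = (\<Prod>k\<in>I. LINT \<omega>|M. \<kappa> k (y k) (X k \<omega>))"
proof -
  \<comment> \<open>On an exceptional null set a factor may fail to be integrable, and the junk value 0 of its
    integral would break the product formula.\<close>
  have "AE y in L. \<forall>k\<in>I. integrable M (\<lambda>\<omega>. \<kappa> k (y k) (X k \<omega>))"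
    by (intro AE_finite_allI[OF finite_I] AE_component kernel_integrable_AE)
  then show ?thesis
  proof eventually_elim
    case (elim y)
    have "smoothed_density (Pi\<^sub>M I marginal_law) (\<lambda>k \<omega>. \<omega> k) y = (\<Prod>k\<in>I. LINT x|marginal_law k. \<kappa> k (y k) x)"
      unfolding smoothed_density_def
      by (intro Q.product_integral_prod finite_I) (use elim in \<open>simp add: marginal_law_eq integrable_distr_eq\<close>)
    then show ?case by (simp add: marginal_law_eq integral_distr)
  qed
qed

lemma vector_char_marginals:
  "vector_char (Pi\<^sub>M I marginal_law) (\<lambda>k \<omega>. \<omega> k) t = (\<Prod>k\<in>I. char (distr M borel (X k)) (t k))"
proof -
  have "vector_char (Pi\<^sub>M I marginal_law) (\<lambda>k \<omega>. \<omega> k) t = (LINT \<omega>|Pi\<^sub>M I marginal_law. (\<Prod>k\<in>I. iexp (t k * \<omega> k)))"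
    unfolding vector_char_def by (simp add: exp_sum[OF finite_I] sum_distrib_left)
  also have "\<dots> = (\<Prod>k\<in>I. LINT x|marginal_law k. iexp (t k * x))"
  proof (intro Q.product_integral_prod finite_I)
    fix k
    show "integrable (marginal_law k) (\<lambda>x. iexp (t k * x))"
      by (rule finite_measure.integrable_const_bound[where B = 1,
            OF prob_space.finite_measure[OF prob_space_marginal_law]])
         (simp_all only: norm_exp_i_times, auto)
  qed
  finally show ?thesis by (simp add: char_def marginal_law_eq)
qed

text \<open>The independent vector is realised by the coordinates on the product of the marginal
  laws. Its smoothed density is the product of expectations only almost everywhere, which is enough
  under the integral; its characteristic function factors at every \<open>t\<close>.\<close>

theorem dependence_square_integral:
  "(LINT y|L. ((LINT \<omega>|M. (\<Prod>k\<in>I. \<kappa> k (y k) (X k \<omega>))) - (\<Prod>k\<in>I. LINT \<omega>|M. \<kappa> k (y k) (X k \<omega>)))\<^sup>2)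
    = (LINT t|L. (\<Prod>k\<in>I. p k (t k)) *
        (cmod ((LINT \<omega>|M. iexp (\<Sum>k\<in>I. t k * X k \<omega>)) - (\<Prod>k\<in>I. char (distr M borel (X k)) (t k))))\<^sup>2)"
proof -
  let ?N = "Pi\<^sub>M I marginal_law"
  have [measurable]: "smoothed_density M X \<in> borel_measurable L"
    "smoothed_density ?N (\<lambda>k \<omega>. \<omega> k) \<in> borel_measurable L"
    by (intro smoothed_density_measurable prob prob_space_marginals X coordinate_measurable; assumption)+
  have "(LINT y|L. (smoothed_density M X y - (\<Prod>k\<in>I. LINT \<omega>|M. \<kappa> k (y k) (X k \<omega>)))\<^sup>2)
      = (LINT y|L. (smoothed_density M X y - smoothed_density ?N (\<lambda>k \<omega>. \<omega> k) y)\<^sup>2)"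
  proof (rule integral_cong_AE)
    show "AE y in L. (smoothed_density M X y - (\<Prod>k\<in>I. LINT \<omega>|M. \<kappa> k (y k) (X k \<omega>)))\<^sup>2
        = (smoothed_density M X y - smoothed_density ?N (\<lambda>k \<omega>. \<omega> k) y)\<^sup>2"
      using smoothed_density_marginals_AE by eventually_elim simp
  qed measurable
  also have "\<dots> = (LINT t|L. (\<Prod>k\<in>I. p k (t k)) * (cmod (vector_char M X t - vector_char ?N (\<lambda>k \<omega>. \<omega> k) t))\<^sup>2)"
    by (intro smoothed_density_diff_square prob prob_space_marginals X coordinate_measurable)
  finally show ?thesis
    unfolding vector_char_marginals unfolding smoothed_density_def vector_char_def .
qed

end

end

section \<open>Specialisation to scaled translates of one kernel\<close>

lemma square_summable_scaled_kernel:
  assumes "square_summable \<K>" and h: "h \<noteq> 0"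
  shows "square_summable (scaled_kernel \<K> h)"
proof -
  have [measurable]: "\<K> \<in> borel_measurable borel" and int: "integrable lborel (\<lambda>x. (\<K> x)\<^sup>2)"
    using assms by (auto simp: square_summable_def)
  have "integrable lborel (\<lambda>x. (\<K> (0 + 1 / h * x))\<^sup>2)"
    using lborel_integrable_real_affine[OF int, of "1 / h" 0] h by simp
  then show ?thesis
    unfolding square_summable_def scaled_kernel_def[abs_def] by (simp add: power_divide)
qed

text \<open>The form of the weight: the correlation of two translates is the autocorrelation at
  \<open>(x - w) / s k\<close>, the frequency substitution \<open>s k * t\<close> moves
  \<open>s k\<close> from the exponent into the transform with Jacobian \<open>s k\<close>, and
  \<open>2 * pi\<close> is the Plancherel constant.\<close>

lemma smoothing_kernels_scaled:
  assumes f: "square_summable f" and fin: "finite I" and s: "\<And>k. k \<in> I \<Longrightarrow> s k > 0"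
  shows "smoothing_kernels I (\<lambda>k y x. f (y - x / s k))
    (\<lambda>k t. s k * (cmod (fourier_transform f (s k * t)))\<^sup>2 / (2 * pi))"
proof
  have [measurable]: "f \<in> borel_measurable borel" and sq: "integrable lborel (\<lambda>x. (f x)\<^sup>2)"
    using f by (auto simp: square_summable_def)
  fix k assume k: "k \<in> I"
  note sk = s[OF k]
  show "(\<lambda>(y, x). f (y - x / s k)) \<in> borel_measurable (borel \<Otimes>\<^sub>M borel)" by measurable
  show "integrable lborel (\<lambda>y. (f (y - x / s k))\<^sup>2)" for x
    using integrable_translate[OF sq, of "- (x / s k)"] by simp
  have "integrable lborel (\<lambda>t. (cmod (fourier_transform f (0 + s k * t)))\<^sup>2)"
    using sk by (intro lborel_integrable_real_affine fourier_transform_autocorrelation(2) f) auto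
  then show "integrable lborel (\<lambda>t. s k * (cmod (fourier_transform f (s k * t)))\<^sup>2 / (2 * pi))"
    by simp
  show "0 \<le> s k * (cmod (fourier_transform f (s k * t)))\<^sup>2 / (2 * pi)" for t
    using sk by simp
  fix x w
  let ?u = "(x - w) / s k"
  let ?G = "\<lambda>t. iexp (t * ?u) * complex_of_real ((cmod (fourier_transform f t))\<^sup>2)"
  \<comment> \<open>Shifting \<open>y\<close> by \<open>x / s k\<close> leaves
    \<open>f y * f (y + ?u)\<close>.\<close>
  have "(LINT y|lborel. f (y - x / s k) * f (y - w / s k)) = autocorrelation f ?u"
    using integral_translate[of "\<lambda>y. f (y - x / s k) * f (y - w / s k)" "x / s k"]
    by (simp add: autocorrelation_def diff_divide_distrib add_diff_eq)
  then have "complex_of_real (LINT y|lborel. f (y - x / s k) * f (y - w / s k)) = (LINT t|lborel. ?G t) / (2 * pi)"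
    unfolding fourier_transform_autocorrelation(3)[OF f] by simp
  also have "(LINT t|lborel. ?G t) = s k *\<^sub>R (LINT t|lborel. ?G (0 + s k * t))"
    using lborel_integral_real_affine[of "s k" ?G 0] sk by simp
  also have "\<dots> / (2 * pi) = (LINT t|lborel. s k *\<^sub>R ?G (s k * t) / (2 * pi))"
    by simp
  also have "\<dots> = (LINT t|lborel. iexp (t * (x - w)) *
      complex_of_real (s k * (cmod (fourier_transform f (s k * t)))\<^sup>2 / (2 * pi)))"
    using sk by (intro Bochner_Integration.integral_cong refl) (simp add: scaleR_conv_of_real)
  finally show "complex_of_real (LINT y|lborel. f (y - x / s k) * f (y - w / s k))
    = (LINT t|lborel. iexp (t * (x - w)) *
      complex_of_real (s k * (cmod (fourier_transform f (s k * t)))\<^sup>2 / (2 * pi)))" .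
qed (rule fin)

theorem lemma2p2:
  fixes M :: "'a measure"
    and Y :: "nat \<Rightarrow> 'a \<Rightarrow> real"
    and K :: nat
    and \<K> :: "real \<Rightarrow> real"
    and h :: real
    and \<sigma> :: "real measure \<Rightarrow> real"
  assumes "prob_space M"
    and "\<And>k. k \<in> {1..K} \<Longrightarrow> Y k \<in> borel_measurable M"
    and "\<And>k. k \<in> {1..K} \<Longrightarrow> integrable M (\<lambda>\<omega>. (Y k \<omega>)\<^sup>2)"
    and "square_summable \<K>"
    and "AE t in lborel. fourier_transform \<K> t \<noteq> 0"
    and "h > 0"
    and "\<And>k. k \<in> {1..K} \<Longrightarrow> \<sigma> (law M (Y k)) > 0"
    and "\<And>k c. k \<in> {1..K} \<Longrightarrow> c \<noteq> 0 \<Longrightarrow>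
           \<sigma> (law M (\<lambda>\<omega>. c * Y k \<omega>)) = \<bar>c\<bar> * \<sigma> (law M (Y k))"
  shows "quadratic_dependence M \<sigma> \<K> h K Y =
    1 / 2 * (LINT y|Pi\<^sub>M {1..K} (\<lambda>_. lborel).
      (\<Prod>k\<in>{1..K}. \<sigma> (law M (Y k))
           * (cmod (fourier_transform (scaled_kernel \<K> h) (\<sigma> (law M (Y k)) * y k)))\<^sup>2 / (2 * pi))
      * (cmod (char_dependence M K Y y))\<^sup>2)"
proof -
  interpret smoothing_kernels "{1..K}" "\<lambda>k y x. scaled_kernel \<K> h (y - x / \<sigma> (law M (Y k)))"
    "\<lambda>k t. \<sigma> (law M (Y k)) * (cmod (fourier_transform (scaled_kernel \<K> h) (\<sigma> (law M (Y k)) * t)))\<^sup>2 / (2 * pi)"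
    using assms by (intro smoothing_kernels_scaled square_summable_scaled_kernel) auto
  show ?thesis
    unfolding quadratic_dependence_def kernel_dependence_def char_dependence_def joint_char_def
    by (simp only: dependence_square_integral[OF assms(1,2)])
qed

end
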